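(* Let $\mathcal{H}$ be a separable infinite dimensional complex Hilbert space and let $S$ be a densely defined closed symmetric operator in $\mathcal{H}$ with equal infinite deficiency indices. Assume that there exists a self-adjoint extension of $S$ in $\mathcal{H}$ with compact resolvent. Let $\mathcal{G}$ be a separable infinite dimensional Hilbert space and let $\Xi$ be a self-adjoint operator in $\mathcal{G}$ with $\mathbb{R}\cap\rho(\Xi)\neq\emptyset$. Then there exists a self-adjoint extension $A$ of $S$ in $\mathcal{H}$ such that $$\sigma_{\mathrm{ess}}(A)=\sigma_{\mathrm{ess}}(\Xi).$$
   Context: Operators are linear and possibly unbounded. The deficiency indices of $S$ are $\dim\ker(S^*-i)$ and $\dim\ker(S^*+i)$. A self-adjoint operator $A$ in $\mathcal{H}$ is an extension of $S$ if $\mathrm{dom}(S)\subset\mathrm{dom}(A)$ and $Af=Sf$ for all $f\in\mathrm{dom}(S)$. $\rho(\cdot)$ denotes the resolvent set. For a self-adjoint operator $T$, the discrete spectrum consists of the isolated points of $\sigma(T)$ that are eigenvalues of finite multiplicity, and $\sigma_{\mathrm{ess}}(T)$ is the complement of the discrete spectrum in $\sigma(T)$. *)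

theory Defs
  imports "HOL-Analysis.Analysis" "HOL-Library.Extended_Nat"
begin

section \<open>Complex Hilbert spaces\<close>

text \<open>
  The Euclidean structure of a complex inner product space is the real part of its
  Hermitian form, so that norm and topology are those of \<^class>\<open>real_inner\<close>. The form is
  linear in the first argument and antilinear in the second.
\<close>

class complex_inner = real_inner +
  fixes scaleC :: "complex \<Rightarrow> 'a \<Rightarrow> 'a" (infixr \<open>*\<^sub>C\<close> 75)
    and cinner :: "'a \<Rightarrow> 'a \<Rightarrow> complex"
  assumes scaleC_add_right: "a *\<^sub>C (x + y) = a *\<^sub>C x + a *\<^sub>C y"
    and scaleC_add_left: "(a + b) *\<^sub>C x = a *\<^sub>C x + b *\<^sub>C x"
    and scaleC_scaleC: "a *\<^sub>C (b *\<^sub>C x) = (a * b) *\<^sub>C x"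
    and scaleC_of_real: "complex_of_real r *\<^sub>C x = r *\<^sub>R x"
    and cinner_add_left: "cinner (x + y) z = cinner x z + cinner y z"
    and cinner_scaleC_left: "cinner (a *\<^sub>C x) y = a * cinner x y"
    and cinner_commute: "cinner x y = cnj (cinner y x)"
    and Re_cinner: "Re (cinner x y) = inner x y"

class complex_hilbert = complex_inner + complete_space

global_interpretation complex_vector:
  vector_space "scaleC :: complex \<Rightarrow> 'a \<Rightarrow> 'a::complex_inner"
proof
  show "1 *\<^sub>C x = x" for x :: 'a
    using scaleC_of_real [of 1 x] by simp
qed (simp_all add: scaleC_add_right scaleC_add_left scaleC_scaleC)

text \<open>
  In a separable Hilbert space a closed subspace has finite or countably infinite Hilbert
  dimension, so that there is only one infinite value. The constant
  \<open>complex_vector.dim\<close> is the algebraic dimension of the span, but it is 0 when that is infinite.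
\<close>

definition cdim :: "'a::complex_inner set \<Rightarrow> enat" where
  "cdim V = (if \<exists>B. finite B \<and> V \<subseteq> complex_vector.span B
             then enat (complex_vector.dim V) else \<infinity>)"


section \<open>Unbounded operators\<close>

text \<open>
  An operator is given by its domain and a map of which only the values on the domain matter;
  operators are therefore compared with \<open>same_op\<close> and not with \<open>=\<close>.
\<close>

datatype 'a unbounded_op = Op (dom_of: "'a set") (app: "'a \<Rightarrow> 'a")

definition linear_op :: "'a::complex_inner unbounded_op \<Rightarrow> bool" where
  "linear_op T \<longleftrightarrow> complex_vector.subspace (dom_of T) \<and>
     (\<forall>x\<in>dom_of T. \<forall>y\<in>dom_of T. app T (x + y) = app T x + app T y) \<and>
     (\<forall>a. \<forall>x\<in>dom_of T. app T (a *\<^sub>C x) = a *\<^sub>C app T x)"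

definition densely_defined :: "'a::complex_inner unbounded_op \<Rightarrow> bool" where
  "densely_defined T \<longleftrightarrow> closure (dom_of T) = UNIV"

definition closed_op :: "'a::complex_inner unbounded_op \<Rightarrow> bool" where
  "closed_op T \<longleftrightarrow> closed ((\<lambda>x. (x, app T x)) ` dom_of T)"

definition symmetric_op :: "'a::complex_inner unbounded_op \<Rightarrow> bool" where
  "symmetric_op T \<longleftrightarrow>
     (\<forall>x\<in>dom_of T. \<forall>y\<in>dom_of T. cinner (app T x) y = cinner x (app T y))"

definition extends :: "'a unbounded_op \<Rightarrow> 'a unbounded_op \<Rightarrow> bool" where
  "extends A S \<longleftrightarrow> dom_of S \<subseteq> dom_of A \<and> (\<forall>x\<in>dom_of S. app A x = app S x)"

definition same_op :: "'a unbounded_op \<Rightarrow> 'a unbounded_op \<Rightarrow> bool" where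
  "same_op A B \<longleftrightarrow> dom_of A = dom_of B \<and> (\<forall>x\<in>dom_of A. app A x = app B x)"

text \<open>The adjoint is meaningful for densely defined operators, where its value is unique.\<close>

definition adjoint_op :: "'a::complex_inner unbounded_op \<Rightarrow> 'a unbounded_op" where
  "adjoint_op T =
     Op {y. \<exists>z. \<forall>x\<in>dom_of T. cinner (app T x) y = cinner x z}
        (\<lambda>y. THE z. \<forall>x\<in>dom_of T. cinner (app T x) y = cinner x z)"

definition self_adjoint :: "'a::complex_inner unbounded_op \<Rightarrow> bool" where
  "self_adjoint T \<longleftrightarrow> linear_op T \<and> densely_defined T \<and> same_op T (adjoint_op T)"

definition ker_shift :: "'a::complex_inner unbounded_op \<Rightarrow> complex \<Rightarrow> 'a set" where
  "ker_shift T z = {x \<in> dom_of T. app T x - z *\<^sub>C x = 0}"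

definition deficiency_plus :: "'a::complex_inner unbounded_op \<Rightarrow> enat" where
  "deficiency_plus S = cdim (ker_shift (adjoint_op S) \<i>)"

definition deficiency_minus :: "'a::complex_inner unbounded_op \<Rightarrow> enat" where
  "deficiency_minus S = cdim (ker_shift (adjoint_op S) (- \<i>))"


section \<open>Resolvent and spectra\<close>

definition resolvent :: "'a::complex_inner unbounded_op \<Rightarrow> complex \<Rightarrow> 'a \<Rightarrow> 'a" where
  "resolvent T z = inv_into (dom_of T) (\<lambda>x. app T x - z *\<^sub>C x)"

text \<open>
  For a linear operator the resolvent is automatically complex linear, so that
  \<^const>\<open>bounded_linear\<close> only adds that it is bounded.
\<close>

definition resolvent_set :: "'a::complex_inner unbounded_op \<Rightarrow> complex set" where
  "resolvent_set T =
     {z. bij_betw (\<lambda>x. app T x - z *\<^sub>C x) (dom_of T) UNIV \<and> bounded_linear (resolvent T z)}"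

definition spectrum :: "'a::complex_inner unbounded_op \<Rightarrow> complex set" where
  "spectrum T = - resolvent_set T"

definition compact_map :: "('a::complex_inner \<Rightarrow> 'a) \<Rightarrow> bool" where
  "compact_map K \<longleftrightarrow> bounded_linear K \<and> (\<forall>B. bounded B \<longrightarrow> compact (closure (K ` B)))"

text \<open>By the resolvent identity, compactness at one point implies compactness at every point.\<close>

definition compact_resolvent :: "'a::complex_inner unbounded_op \<Rightarrow> bool" where
  "compact_resolvent T \<longleftrightarrow> (\<exists>z\<in>resolvent_set T. compact_map (resolvent T z))"

definition discrete_spectrum :: "'a::complex_inner unbounded_op \<Rightarrow> complex set" where
  "discrete_spectrum T =
     {z. z isolated_in spectrum T \<and> ker_shift T z \<noteq> {0} \<and> cdim (ker_shift T z) < \<infinity>}"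

definition essential_spectrum :: "'a::complex_inner unbounded_op \<Rightarrow> complex set" where
  "essential_spectrum T = spectrum T - discrete_spectrum T"

end

theory Submission
  imports Defs
begin

text \<open>
  The resolvent set of the given extension \<open>A\<^sub>0\<close> with compact resolvent and that of \<open>\<Xi>\<close> share
  a real point \<open>\<eta>\<close>. Since the deficiency spaces are infinite dimensional, there is an isometry \<open>\<iota>\<close> of
  the space of \<open>\<Xi>\<close> into the orthogonal complement of the range of \<open>S - \<eta>\<close>. The operator
  \<open>B = (A\<^sub>0 - \<eta>)\<^sup>-\<^sup>1 + \<iota> (\<Xi> - \<eta>)\<^sup>-\<^sup>1 \<iota>\<^sup>*\<close> is bounded, self-adjoint and injective, and it
  is a left inverse of \<open>S - \<eta>\<close>, so that \<open>A = \<eta> + B\<^sup>-\<^sup>1\<close> is a self-adjoint extension of \<open>S\<close> (Krein's formula).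
  A point \<open>\<lambda> \<noteq> \<eta>\<close> is in the essential spectrum of \<open>A\<close> iff \<open>B - \<mu>\<close> with \<open>\<mu> = 1 / (\<lambda> - \<eta>)\<close> is not
  Fredholm. As the first summand of \<open>B\<close> is compact, this only depends on \<open>(\<Xi> - \<eta>)\<^sup>-\<^sup>1 - \<mu>\<close>.
\<close>

section \<open>Inner products and orthogonal projections\<close>

text \<open>The point \<eta> is real so that both summands of \<open>B\<close> are self-adjoint. It
  exists because the real part of the resolvent set of \<Xi> is open, while the spectrum of an
  operator with compact resolvent fills no real interval. Infinite deficiency is carried from
  \<open>\<i>\<close> to \<eta>, both being regular points of \<open>A\<^sub>0\<close>. Injectivity
  of \<open>B\<close> rests on the density of \<open>dom S\<close>: if \<open>B x = 0\<close>, then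
  \<open>(A\<^sub>0 - \<eta>)^-1 x\<close> lies in the range of \<iota>, so it is orthogonal to the
  range of \<open>S - \<eta>\<close>, and moving \<open>A\<^sub>0 - \<eta>\<close> across shows
  \<open>x\<close> orthogonal to \<open>dom S\<close>. The obstacle is that the discrete spectrum is
  defined by isolation and finite multiplicity, which do not behave well under compact
  perturbations. They are traded for a condition on bounded sequences. The hard half of this trade
  is that an isolated spectral point gives a closed range; instead of spectral projections it uses
  that a bounded self-adjoint operator has norm at most its spectral radius. The value \<mu> = 0,
  where the complement of the range of \<iota> would interfere, corresponds to no finite
  \<lambda>.\<close>

instance complex_hilbert \<subseteq> banach ..

lemma cinner_add_right: "cinner x (y + z) = cinner x y + cinner x (z::'a::complex_inner)"
  by (metis cinner_add_left cinner_commute complex_cnj_add)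

lemma cinner_scaleC_right: "cinner x (a *\<^sub>C y) = cnj a * cinner x (y::'a::complex_inner)"
  by (metis cinner_commute cinner_scaleC_left complex_cnj_mult)

lemma cinner_scaleR_left: "cinner (r *\<^sub>R x) y = of_real r * cinner x (y::'a::complex_inner)"
  by (metis cinner_scaleC_left scaleC_of_real)

lemma cinner_scaleR_right: "cinner x (r *\<^sub>R y) = of_real r * cinner x (y::'a::complex_inner)"
  by (metis cinner_scaleC_right complex_cnj_complex_of_real scaleC_of_real)

lemma cinner_zero_left [simp]: "cinner 0 (y::'a::complex_inner) = 0"
  using cinner_add_left[of 0 0 y] by simp

lemma cinner_zero_right [simp]: "cinner (y::'a::complex_inner) 0 = 0"
  using cinner_add_right[of y 0 0] by simp

lemma cinner_minus_left: "cinner (- x) y = - cinner x (y::'a::complex_inner)"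
  using cinner_add_left[of x "-x" y] by (simp add: add_eq_0_iff)

lemma cinner_minus_right: "cinner x (- y) = - cinner x (y::'a::complex_inner)"
  using cinner_add_right[of x y "-y"] by (simp add: add_eq_0_iff)

lemma cinner_diff_left: "cinner (x - y) z = cinner x z - cinner y (z::'a::complex_inner)"
  using cinner_add_left[of x "-y" z] by (simp add: cinner_minus_left)

lemma cinner_diff_right: "cinner x (y - z) = cinner x y - cinner x (z::'a::complex_inner)"
  using cinner_add_right[of x y "-z"] by (simp add: cinner_minus_right)

lemma cinner_sum_left: "cinner (sum f A) y = (\<Sum>k\<in>A. cinner (f k) (y::'a::complex_inner))"
  by (induction A rule: infinite_finite_induct) (auto simp: cinner_add_left)

lemma cinner_sum_right: "cinner y (sum f A) = (\<Sum>k\<in>A. cinner (y::'a::complex_inner) (f k))"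
  by (induction A rule: infinite_finite_induct) (auto simp: cinner_add_right)

lemmas cinner_simps = cinner_add_left cinner_add_right cinner_diff_left cinner_diff_right
  cinner_minus_left cinner_minus_right cinner_scaleC_left cinner_scaleC_right
  cinner_scaleR_left cinner_scaleR_right

lemma scaleC_diff_right: "a *\<^sub>C (x - y) = a *\<^sub>C x - a *\<^sub>C (y::'a::complex_inner)"
  by (rule complex_vector.scale_right_diff_distrib)

lemma cinner_self: "cinner x x = of_real ((norm (x::'a::complex_inner))\<^sup>2)"
proof (rule complex_eqI)
  have "cinner x x = cnj (cinner x x)" by (rule cinner_commute)
  then have "Im (cinner x x) = - Im (cinner x x)" by (metis cnj.simps(2))
  then show "Im (cinner x x) = Im (of_real ((norm x)\<^sup>2))" by simp
qed (simp add: Re_cinner dot_square_norm)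

lemma norm_eq_cinner: "(norm (x::'a::complex_inner))\<^sup>2 = Re (cinner x x)"
  by (simp add: cinner_self)

lemma norm_scaleC: "norm (a *\<^sub>C x) = cmod a * norm (x::'a::complex_inner)"
proof -
  have "complex_of_real ((norm (a *\<^sub>C x))\<^sup>2) = (a * cnj a) * cinner x x"
    by (simp only: cinner_self[symmetric] cinner_scaleC_left cinner_scaleC_right mult_ac)
  also have "\<dots> = of_real ((cmod a * norm x)\<^sup>2)"
    by (simp add: cinner_self power_mult_distrib flip: complex_norm_square)
  finally have "(norm (a *\<^sub>C x))\<^sup>2 = (cmod a * norm x)\<^sup>2"
    using of_real_eq_iff by blast
  then show ?thesis
    by (rule power2_eq_imp_eq) auto
qed

lemma cinner_cauchy_schwarz: "cmod (cinner x y) \<le> norm x * norm (y::'a::complex_inner)"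
proof (cases "cinner x y = 0")
  case False
  \<comment> \<open>The phase \<open>a\<close> has modulus one and rotates \<open>cinner x y\<close>
    onto its modulus, so the Cauchy-Schwarz inequality of the real inner product applies to
    \<open>a *\<^sub>C x\<close> and \<open>y\<close>.\<close>
  define a where "a = cnj (cinner x y) / cmod (cinner x y)"
  have "a * cinner x y = of_real (cmod (cinner x y))"
    using False unfolding a_def
    by (simp add: complex_norm_square[symmetric] power2_eq_square field_simps)
  then have "cmod (cinner x y) = inner (a *\<^sub>C x) y"
    by (metis Re_cinner Re_complex_of_real cinner_scaleC_left)
  also have "\<dots> \<le> norm (a *\<^sub>C x) * norm y" by (rule norm_cauchy_schwarz)
  also have "\<dots> = norm x * norm y"
    using False by (simp add: norm_scaleC a_def norm_divide)
  finally show ?thesis .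
qed simp

lemma bounded_bilinear_cinner: "bounded_bilinear (cinner :: 'a::complex_inner \<Rightarrow> _)"
proof
  show "\<exists>K. \<forall>(a::'a) b. norm (cinner a b) \<le> norm a * norm b * K"
    using cinner_cauchy_schwarz by (metis mult.right_neutral)
qed (auto simp: cinner_simps scaleR_conv_of_real)

lemmas tendsto_cinner [tendsto_intros] = bounded_bilinear.tendsto[OF bounded_bilinear_cinner]

lemma bounded_bilinear_scaleC: "bounded_bilinear (scaleC :: _ \<Rightarrow> 'a::complex_inner \<Rightarrow> _)"
proof
  show "\<exists>K. \<forall>a (b::'a). norm (a *\<^sub>C b) \<le> norm a * norm b * K"
    by (intro exI[of _ 1]) (simp add: norm_scaleC)
  show "(r *\<^sub>R a) *\<^sub>C b = r *\<^sub>R a *\<^sub>C b" for r a and b :: 'a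
    by (metis scaleC_of_real scaleC_scaleC scaleR_conv_of_real)
  show "a *\<^sub>C r *\<^sub>R b = r *\<^sub>R a *\<^sub>C b" for r a and b :: 'a
    by (metis scaleC_of_real scaleC_scaleC mult.commute)
qed (auto simp: scaleC_add_right scaleC_add_left)

lemmas tendsto_scaleC [tendsto_intros] = bounded_bilinear.tendsto[OF bounded_bilinear_scaleC]
lemmas bounded_linear_scaleC = bounded_bilinear.bounded_linear_right[OF bounded_bilinear_scaleC]

lemma cinner_eq_zero_iff [simp]: "cinner x x = 0 \<longleftrightarrow> (x::'a::complex_inner) = 0"
  by (simp add: cinner_self)

lemma norm_add_orthogonal:
  assumes "cinner x y = 0"
  shows "(norm (x + y :: 'a::complex_inner))\<^sup>2 = (norm x)\<^sup>2 + (norm y)\<^sup>2"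
proof -
  have "cinner y x = 0" using assms by (metis cinner_commute complex_cnj_zero)
  then show ?thesis using assms by (simp add: norm_eq_cinner cinner_simps)
qed

lemma cinner_zero_commute: "cinner x y = 0 \<longleftrightarrow> cinner y (x::'a::complex_inner) = 0"
  by (metis cinner_commute complex_cnj_zero)

section \<open>Projection onto closed subspaces and the orthogonality test for density\<close>

lemma complex_subspace_closure:
  assumes "complex_vector.subspace (M :: 'a::complex_inner set)"
  shows "complex_vector.subspace (closure M)"
proof (rule complex_vector.subspaceI)
  show "0 \<in> closure M" using assms closure_subset complex_vector.subspace_0 by blast
next
  fix x y assume "x \<in> closure M" "y \<in> closure M"
  then obtain f g where "\<And>n. f n \<in> M" "f \<longlonglongrightarrow> x" "\<And>n. g n \<in> M" "g \<longlonglongrightarrow> y"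
    by (auto simp: closure_sequential)
  then show "x + y \<in> closure M"
    by (auto simp: closure_sequential intro!: exI[of _ "\<lambda>n. f n + g n"] tendsto_add
        complex_vector.subspace_add[OF assms])
next
  fix a x assume "x \<in> closure M"
  then obtain f where "\<And>n. f n \<in> M" "f \<longlonglongrightarrow> x" by (auto simp: closure_sequential)
  then show "a *\<^sub>C x \<in> closure M"
    by (auto simp: closure_sequential intro!: exI[of _ "\<lambda>n. a *\<^sub>C f n"] tendsto_intros
        complex_vector.subspace_scale[OF assms])
qed

text \<open>Removing the component of \<open>u\<close> along \<open>y\<close> shortens
  \<open>u\<close> by Pythagoras, unless that component is zero.\<close>

lemma nearest_point_orthogonal:
  fixes u :: "'a::complex_inner"
  assumes "\<And>a. norm u \<le> norm (u - a *\<^sub>C y)"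
  shows "cinner u y = 0"
proof (cases "y = 0")
  case False
  define a where "a = cinner u y / of_real ((norm y)\<^sup>2)"
  have o: "cinner (u - a *\<^sub>C y) (a *\<^sub>C y) = 0"
    using False by (simp add: cinner_simps cinner_self a_def)
  have "(norm u)\<^sup>2 = (norm (u - a *\<^sub>C y))\<^sup>2 + (norm (a *\<^sub>C y))\<^sup>2"
    using norm_add_orthogonal[OF o] by simp
  then have "norm (a *\<^sub>C y) = 0" using assms[of a]
    by (smt (verit) norm_ge_zero power2_less_0 power_mono zero_eq_power2)
  then have "a = 0" using False by (simp add: norm_scaleC)
  then show ?thesis using False by (simp add: a_def)
qed simp

lemma orthogonal_projection:
  fixes M :: "'a::complex_hilbert set"
  assumes M: "complex_vector.subspace M" and cl: "closed M"
  obtains m where "m \<in> M" "\<And>y. y \<in> M \<Longrightarrow> cinner (x - m) y = 0"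
proof -
  define d where "d = infdist x M"
  have ne: "M \<noteq> {}" using M complex_vector.subspace_0 by blast
  have d: "d \<le> dist x y" if "y \<in> M" for y
    unfolding d_def using that by (rule infdist_le)
  have d0: "d \<ge> 0" unfolding d_def by (rule infdist_nonneg)
  have "\<exists>m\<in>M. dist x m < d + 1 / Suc n" for n
  proof (rule ccontr)
    assume "\<not> ?thesis"
    then have "d + 1 / Suc n \<le> (INF m\<in>M. dist x m)"
      by (intro cINF_greatest ne) force
    then show False unfolding d_def infdist_notempty[OF ne] by simp
  qed
  then obtain m where m: "\<And>n. m n \<in> M" "\<And>n. dist x (m n) < d + 1 / Suc n" by metis
  \<comment> \<open>Parallelogram identity for \<open>x - m i\<close> and \<open>x - m j\<close>:
    the midpoint of \<open>m i\<close> and \<open>m j\<close> lies in \<open>M\<close>, so it is at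
    distance at least \<open>d\<close> from \<open>x\<close>. This makes the minimising sequence
    Cauchy.\<close>
  have gap: "(dist (m i) (m j))\<^sup>2 \<le> 2 * (d + 1 / Suc i)\<^sup>2 + 2 * (d + 1 / Suc j)\<^sup>2 - 4 * d\<^sup>2" for i j
  proof -
    have mid: "(1/2::real) *\<^sub>R (m i + m j) \<in> M"
      using m(1) M by (metis complex_vector.subspace_add complex_vector.subspace_scale scaleC_of_real)
    have "d\<^sup>2 \<le> (dist x ((1/2::real) *\<^sub>R (m i + m j)))\<^sup>2"
      using d[OF mid] d0 by (rule power_mono)
    also have "\<dots> = (norm ((1/2::real) *\<^sub>R ((x - m i) + (x - m j))))\<^sup>2"
      by (simp add: dist_norm algebra_simps flip: scaleR_add_left)
    finally have "4 * d\<^sup>2 \<le> (norm ((x - m i) + (x - m j)))\<^sup>2"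
      by (simp add: power_divide)
    moreover have "(norm ((x - m i) + (x - m j)))\<^sup>2 + (norm ((x - m i) - (x - m j)))\<^sup>2
        = 2 * (norm (x - m i))\<^sup>2 + 2 * (norm (x - m j))\<^sup>2"
      by (simp add: power2_norm_eq_inner inner_simps inner_commute)
    moreover have "(norm (x - m k))\<^sup>2 \<le> (d + 1 / Suc k)\<^sup>2" for k
      using m(2)[of k] by (intro power_mono) (auto simp: dist_norm)
    note this[of i] this[of j]
    moreover have "(dist (m i) (m j))\<^sup>2 = (norm ((x - m i) - (x - m j)))\<^sup>2"
      by (simp add: dist_norm norm_minus_commute)
    ultimately show ?thesis by linarith
  qed
  have lim: "(\<lambda>n. 1 / real (Suc n)) \<longlonglongrightarrow> 0" by (rule LIMSEQ_Suc[OF lim_1_over_n])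
  have "Cauchy m"
  proof (rule CauchyI')
    fix e :: real assume e: "e > 0"
    have "(\<lambda>n. 4 * (d + 1 / Suc n)\<^sup>2 - 4 * d\<^sup>2) \<longlonglongrightarrow> 4 * (d + 0)\<^sup>2 - 4 * d\<^sup>2"
      by (intro tendsto_intros lim)
    then have "\<forall>\<^sub>F n in sequentially. 4 * (d + 1 / Suc n)\<^sup>2 - 4 * d\<^sup>2 < e\<^sup>2"
      by (rule order_tendstoD(2)) (use e in auto)
    then obtain N where N: "4 * (d + 1 / Suc N)\<^sup>2 - 4 * d\<^sup>2 < e\<^sup>2"
      by (auto simp: eventually_sequentially)
    have "dist (m i) (m j) < e" if "i \<ge> N" "j > i" for i j
    proof -
      have *: "(d + 1 / Suc k)\<^sup>2 \<le> (d + 1 / Suc N)\<^sup>2" if "k \<ge> N" for k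
        using that d0 by (intro power_mono add_left_mono) (auto simp: frac_le)
      have "(dist (m i) (m j))\<^sup>2 < e\<^sup>2"
        using gap[of i j] *[of i] *[of j] that N by linarith
      then show ?thesis using e by (simp add: power_less_imp_less_base)
    qed
    then show "\<exists>M. \<forall>i\<ge>M. \<forall>j>i. dist (m i) (m j) < e" by blast
  qed
  then obtain z where z: "m \<longlonglongrightarrow> z" by (meson Cauchy_convergent convergent_def)
  have zM: "z \<in> M" using cl m(1) z by (meson closed_sequentially)
  have "dist x z \<le> d + 0"
    by (rule LIMSEQ_le[OF tendsto_dist[OF tendsto_const z] tendsto_add[OF tendsto_const lim]])
      (use m(2) less_imp_le in auto)
  then have min: "norm (x - z) \<le> norm (x - z - a *\<^sub>C y)" if "y \<in> M" for a y
    using d[of "z + a *\<^sub>C y"] zM that M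
    by (simp add: dist_norm complex_vector.subspace_add complex_vector.subspace_scale diff_diff_eq)
  show thesis using zM that nearest_point_orthogonal[OF min] by blast
qed

lemma dense_iff_orthogonal:
  fixes M :: "'a::complex_hilbert set"
  assumes "complex_vector.subspace M"
  shows "closure M = UNIV \<longleftrightarrow> (\<forall>x. (\<forall>y\<in>M. cinner x y = 0) \<longrightarrow> x = 0)"
proof
  assume M: "closure M = UNIV"
  show "\<forall>x. (\<forall>y\<in>M. cinner x y = 0) \<longrightarrow> x = 0"
  proof (intro allI impI)
    fix x assume x: "\<forall>y\<in>M. cinner x y = 0"
    obtain f where f: "\<And>n. f n \<in> M" "f \<longlonglongrightarrow> x" using M by (metis UNIV_I closure_sequential)
    have "(\<lambda>n. cinner x (f n)) \<longlonglongrightarrow> cinner x x" by (intro tendsto_intros f)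
    then have "cinner x x = 0" using x f(1) by (simp add: LIMSEQ_const_iff)
    then show "x = 0" by simp
  qed
next
  assume *: "\<forall>x. (\<forall>y\<in>M. cinner x y = 0) \<longrightarrow> x = 0"
  show "closure M = UNIV"
  proof (intro equalityI subset_UNIV subsetI)
    fix x :: 'a
    obtain m where "m \<in> closure M" "\<And>y. y \<in> closure M \<Longrightarrow> cinner (x - m) y = 0"
      using orthogonal_projection[OF complex_subspace_closure[OF assms] closed_closure] by blast
    then show "x \<in> closure M" using * closure_subset by (metis eq_iff_diff_eq_0 subsetD)
  qed
qed

section \<open>Orthonormal sequences\<close>

definition bounded_clinear :: "('a::complex_inner \<Rightarrow> 'b::complex_inner) \<Rightarrow> bool" where
  "bounded_clinear L \<longleftrightarrow> bounded_linear L \<and> (\<forall>a x. L (a *\<^sub>C x) = a *\<^sub>C L x)"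

text \<open>Zero entries are allowed, so that Gram--Schmidt applies to dependent sequences.\<close>

definition orthonormal0 :: "(nat \<Rightarrow> 'a::complex_inner) \<Rightarrow> bool" where
  "orthonormal0 e \<longleftrightarrow> (\<forall>i j. i \<noteq> j \<longrightarrow> cinner (e i) (e j) = 0) \<and> (\<forall>i. e i = 0 \<or> norm (e i) = 1)"

lemma orthonormal0_scaleC_self: "orthonormal0 e \<Longrightarrow> cinner (e k) (e k) *\<^sub>C e k = e k"
  unfolding orthonormal0_def cinner_self by (metis complex_vector.scale_one complex_vector.scale_zero_right of_real_1 one_power2)

lemma orthonormal0_mult_self:
  "orthonormal0 e \<Longrightarrow> cinner x (e k) * cinner (e k) (e k) = cinner x (e k)"
  unfolding orthonormal0_def cinner_self by (metis cinner_zero_right mult.right_neutral mult_zero_left of_real_1 one_power2)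

text \<open>\<open>sgn\<close> is normalisation with \<open>sgn 0 = 0\<close>: a vector that depends
  on its predecessors yields a zero entry instead of stopping the process.\<close>

fun gram_schmidt :: "(nat \<Rightarrow> 'a::complex_inner) \<Rightarrow> nat \<Rightarrow> 'a" where
  "gram_schmidt d n = sgn (d n - (\<Sum>k<n. cinner (d n) (gram_schmidt d k) *\<^sub>C gram_schmidt d k))"

declare gram_schmidt.simps [simp del]

lemma gram_schmidt_norm: "gram_schmidt d n = 0 \<or> norm (gram_schmidt d n) = 1"
  unfolding gram_schmidt.simps[of d n] by (simp add: norm_sgn sgn_zero_iff)

lemma gram_schmidt_orthogonal: "j < n \<Longrightarrow> cinner (gram_schmidt d n) (gram_schmidt d j) = 0"
proof (induction n arbitrary: j rule: less_induct)
  case (less n)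
  let ?g = "gram_schmidt d"
  have orth: "cinner (?g k) (?g j) = 0" if "k < n" "k \<noteq> j" for k
    using less that by (metis linorder_neqE_nat cinner_zero_commute)
  have "(\<Sum>k<n. cinner (d n) (?g k) * cinner (?g k) (?g j))
      = (\<Sum>k<n. if k = j then cinner (d n) (?g j) * cinner (?g j) (?g j) else 0)"
    by (rule sum.cong) (auto simp: orth)
  also have "\<dots> = cinner (d n) (?g j) * cinner (?g j) (?g j)" using less.prems by simp
  also have "\<dots> = cinner (d n) (?g j)"
    using gram_schmidt_norm[of d j] by (auto simp: cinner_self)
  finally show ?case
    by (subst gram_schmidt.simps)
      (simp add: sgn_div_norm cinner_simps cinner_sum_left)
qed

lemma orthonormal0_gram_schmidt: "orthonormal0 (gram_schmidt d)"
  unfolding orthonormal0_def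
  using gram_schmidt_norm gram_schmidt_orthogonal by (metis linorder_neqE_nat cinner_zero_commute)

lemma gram_schmidt_expand:
  obtains r :: real where "d n = (\<Sum>k<n. cinner (d n) (gram_schmidt d k) *\<^sub>C gram_schmidt d k)
    + r *\<^sub>R gram_schmidt d n"
proof
  let ?u = "d n - (\<Sum>k<n. cinner (d n) (gram_schmidt d k) *\<^sub>C gram_schmidt d k)"
  have "norm u *\<^sub>R sgn u = u" for u :: 'a
    by (cases "u = 0") (auto simp: sgn_div_norm)
  then have "norm ?u *\<^sub>R gram_schmidt d n = ?u"
    unfolding gram_schmidt.simps[of d n] .
  then show "d n = (\<Sum>k<n. cinner (d n) (gram_schmidt d k) *\<^sub>C gram_schmidt d k)
    + norm ?u *\<^sub>R gram_schmidt d n" by simp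
qed

lemma span_scaleR: "x \<in> complex_vector.span B \<Longrightarrow> r *\<^sub>R (x::'a::complex_inner) \<in> complex_vector.span B"
  by (metis complex_vector.span_scale scaleC_of_real)

lemma in_span_gram_schmidt:
  assumes "k < n"
  shows "d k \<in> complex_vector.span (gram_schmidt d ` {..<n})"
proof -
  obtain r :: real where "d k = (\<Sum>j<k. cinner (d k) (gram_schmidt d j) *\<^sub>C gram_schmidt d j)
    + r *\<^sub>R gram_schmidt d k" by (rule gram_schmidt_expand)
  moreover have "gram_schmidt d j \<in> complex_vector.span (gram_schmidt d ` {..<n})" if "j \<le> k" for j
    using that assms by (intro complex_vector.span_base) auto
  ultimately show ?thesis
    by (metis (no_types, lifting) complex_vector.span_add complex_vector.span_sum complex_vector.span_scale
        span_scaleR lessThan_iff less_imp_le order_refl)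
qed

lemma gram_schmidt_in_subspace:
  assumes "complex_vector.subspace V" "\<And>k. k \<le> n \<Longrightarrow> d k \<in> V"
  shows "gram_schmidt d n \<in> V"
  using assms(2)
proof (induction n rule: less_induct)
  case (less n)
  have "d n - (\<Sum>k<n. cinner (d n) (gram_schmidt d k) *\<^sub>C gram_schmidt d k) \<in> V"
    using less by (intro complex_vector.subspace_diff complex_vector.subspace_sum
        complex_vector.subspace_scale assms(1)) auto
  then show ?case
    unfolding gram_schmidt.simps[of d n] sgn_div_norm
    by (metis assms(1) complex_vector.subspace_scale scaleC_of_real)
qed

lemma orthonormal0_expand:
  assumes e: "orthonormal0 e" and "x \<in> complex_vector.span (e ` {..<n::nat})"
  shows "x = (\<Sum>k<n. cinner x (e k) *\<^sub>C e k)"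
proof -
  have "complex_vector.span (e ` {..<n}) \<subseteq> {x. x = (\<Sum>k<n. cinner x (e k) *\<^sub>C e k)}"
  proof (rule complex_vector.span_minimal)
    show "complex_vector.subspace {x. x = (\<Sum>k<n. cinner x (e k) *\<^sub>C e k)}"
      by (rule complex_vector.subspaceI)
        (auto simp: cinner_simps scaleC_add_left sum.distrib simp flip: scaleC_scaleC
          complex_vector.scale_sum_right)
    have "(\<Sum>k<n. cinner (e j) (e k) *\<^sub>C e k) = e j" if "j < n" for j
    proof -
      have "(\<Sum>k<n. cinner (e j) (e k) *\<^sub>C e k) = (\<Sum>k<n. if k = j then e j else 0)"
        using e by (intro sum.cong) (auto simp: orthonormal0_scaleC_self orthonormal0_def)
      then show ?thesis using that by simp
    qed
    then show "e ` {..<n} \<subseteq> {x. x = (\<Sum>k<n. cinner x (e k) *\<^sub>C e k)}" by auto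
  qed
  then show ?thesis using assms(2) by auto
qed

section \<open>Bolzano-Weierstrass in finite dimension, orthonormal sequences in infinite
  dimension\<close>

lemma simultaneous_convergent_subsequence:
  fixes f :: "nat \<Rightarrow> nat \<Rightarrow> complex"
  assumes "\<And>k. k < n \<Longrightarrow> bounded (range (f k))"
  shows "\<exists>r::nat\<Rightarrow>nat. strict_mono r \<and> (\<forall>k<n. convergent (f k \<circ> r))"
  using assms
proof (induction n)
  case 0
  then show ?case by (auto intro!: exI[of _ id] strict_mono_id)
next
  case (Suc n)
  from Suc.IH[OF Suc.prems[OF less_SucI]]
  obtain r :: "nat \<Rightarrow> nat" where r: "strict_mono r" "\<And>k. k < n \<Longrightarrow> convergent (f k \<circ> r)"
    by blast
  have "bounded (range (f n \<circ> r))"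
    by (rule bounded_subset[OF Suc.prems[of n]]) auto
  from bounded_imp_convergent_subsequence[OF this]
  obtain l s where s: "strict_mono s" "((f n \<circ> r) \<circ> s) \<longlonglongrightarrow> l" by blast
  have "convergent (f k \<circ> (r \<circ> s))" if "k < Suc n" for k
  proof (cases "k = n")
    case True
    then show ?thesis using s(2) by (auto simp: convergent_def comp_assoc)
  next
    case False
    then show ?thesis
      using convergent_subseq_convergent[OF r(2) s(1)] that by (simp add: comp_assoc)
  qed
  then show ?case using strict_mono_o[OF r(1) s(1)] by blast
qed

lemma cdim_finite_iff: "cdim V < \<infinity> \<longleftrightarrow> (\<exists>B. finite B \<and> V \<subseteq> complex_vector.span B)"
  by (simp add: cdim_def)

text \<open>Coordinates with respect to a finite orthonormalised spanning family are bounded by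
  Cauchy-Schwarz, so finitely many successive extractions make all of them converge. The limit is
  only claimed to exist in the ambient space.\<close>

lemma finite_cdim_convergent_subsequence:
  fixes x :: "nat \<Rightarrow> 'a::complex_inner"
  assumes "cdim V < \<infinity>" "\<And>n. x n \<in> V" "bounded (range x)"
  shows "\<exists>r::nat\<Rightarrow>nat. strict_mono r \<and> convergent (x \<circ> r)"
proof -
  obtain B where "finite B" and VB: "V \<subseteq> complex_vector.span B"
    using assms(1) cdim_finite_iff by blast
  then obtain d :: "nat \<Rightarrow> 'a" and n where d: "B = d ` {..<n}"
    by (metis ex_bij_betw_nat_finite bij_betw_imp_surj_on atLeast0LessThan)
  define e where "e = gram_schmidt d"
  have e: "orthonormal0 e" unfolding e_def by (rule orthonormal0_gram_schmidt)
  have "B \<subseteq> complex_vector.span (e ` {..<n})"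
    using in_span_gram_schmidt unfolding d e_def by blast
  then have "V \<subseteq> complex_vector.span (e ` {..<n})"
    using VB complex_vector.span_minimal complex_vector.subspace_span by blast
  then have xe: "x i = (\<Sum>k<n. cinner (x i) (e k) *\<^sub>C e k)" for i
    using orthonormal0_expand[OF e] assms(2) by blast
  obtain M where M: "\<And>i. norm (x i) \<le> M" using assms(3) unfolding bounded_iff by blast
  have "bounded (range (\<lambda>i. cinner (x i) (e k)))" for k
  proof (rule boundedI[of _ M])
    fix z assume "z \<in> range (\<lambda>i. cinner (x i) (e k))"
    then obtain i where "z = cinner (x i) (e k)" by blast
    moreover have "norm (e k) \<le> 1"
      using e unfolding orthonormal0_def by (metis norm_zero order_refl zero_le_one)
    moreover have "norm (x i) * norm (e k) \<le> norm (x i) * 1"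
      using calculation(2) by (intro mult_left_mono) auto
    ultimately show "norm z \<le> M"
      using cinner_cauchy_schwarz[of "x i" "e k"] M[of i] by simp
  qed
  then obtain r where r: "strict_mono r" "\<And>k. k < n \<Longrightarrow> convergent ((\<lambda>i. cinner (x i) (e k)) \<circ> r)"
    using simultaneous_convergent_subsequence[of n "\<lambda>k i. cinner (x i) (e k)"] by blast
  then obtain l where l: "\<And>k. k < n \<Longrightarrow> (\<lambda>i. cinner (x (r i)) (e k)) \<longlonglongrightarrow> l k"
    unfolding convergent_def o_def by metis
  have "(\<lambda>i. \<Sum>k<n. cinner (x (r i)) (e k) *\<^sub>C e k) \<longlonglongrightarrow> (\<Sum>k<n. l k *\<^sub>C e k)"
    by (intro tendsto_sum tendsto_scaleC l tendsto_const) auto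
  then have "convergent (x \<circ> r)" using xe by (auto simp: convergent_def o_def)
  then show ?thesis using r(1) by blast
qed

lemma infinite_cdim_orthonormal:
  fixes V :: "'a::complex_inner set"
  assumes V: "complex_vector.subspace V" and "cdim V = \<infinity>"
  obtains e where "orthonormal0 e" "\<And>n::nat. e n \<in> V" "\<And>n. norm (e n) = 1"
proof -
  have ex: "\<exists>x. x \<in> V \<and> x \<notin> complex_vector.span B" if "finite B" for B
    using assms(2) that unfolding cdim_def by (metis enat.distinct(1) subsetI)
  \<comment> \<open>Each vector is chosen outside the span of the earlier ones, which is possible as
    no finite set spans \<open>V\<close>; Gram-Schmidt then never produces a zero entry.\<close>
  have "\<exists>d. \<forall>n. d n \<in> V \<and> d n \<notin> complex_vector.span (d ` {..<n::nat})"
  proof (rule dependent_wellorder_choice)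
    fix x n and f g :: "nat \<Rightarrow> 'a"
    assume fg: "\<And>y. y < n \<Longrightarrow> f y = g y"
    have "f ` {..<n} = g ` {..<n}" by (rule image_cong) (simp_all add: fg)
    then show "(x \<in> V \<and> x \<notin> complex_vector.span (f ` {..<n}))
      = (x \<in> V \<and> x \<notin> complex_vector.span (g ` {..<n}))" by simp
  next
    fix n and f :: "nat \<Rightarrow> 'a"
    show "\<exists>x. x \<in> V \<and> x \<notin> complex_vector.span (f ` {..<n})"
      by (rule ex) simp
  qed
  then obtain d where d: "\<And>n. d n \<in> V" "\<And>n. d n \<notin> complex_vector.span (d ` {..<n::nat})" by blast
  have "gram_schmidt d n \<noteq> 0" for n
  proof
    assume "gram_schmidt d n = 0"
    moreover obtain r :: real where "d n = (\<Sum>j<n. cinner (d n) (gram_schmidt d j) *\<^sub>C gram_schmidt d j)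
      + r *\<^sub>R gram_schmidt d n" by (rule gram_schmidt_expand)
    moreover have "gram_schmidt d j \<in> complex_vector.span (d ` {..<n})" if "j < n" for j
      using that by (intro gram_schmidt_in_subspace complex_vector.subspace_span complex_vector.span_base) auto
    ultimately have "d n \<in> complex_vector.span (d ` {..<n})"
      by (metis (no_types, lifting) add.right_neutral complex_vector.span_scale complex_vector.span_sum
          lessThan_iff scaleR_zero_right)
    then show False using d(2) by blast
  qed
  then have "norm (gram_schmidt d n) = 1" for n
    using gram_schmidt_norm by blast
  with orthonormal0_gram_schmidt gram_schmidt_in_subspace[OF V d(1)] show thesis
    by (rule that)
qed

text \<open>Two distinct members are at distance \<open>sqrt 2\<close>, so no subsequence is Cauchy.
  This is how infinite dimension contradicts compactness.\<close>

lemma orthonormal_not_convergent: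
  fixes e :: "nat \<Rightarrow> 'a::complex_inner"
  assumes "\<And>i j. i \<noteq> j \<Longrightarrow> cinner (e i) (e j) = 0" "\<And>n. norm (e n) = 1" "strict_mono r"
  shows "\<not> convergent (e \<circ> r)"
proof
  assume "convergent (e \<circ> r)"
  then have "Cauchy (e \<circ> r)" by (rule convergent_Cauchy)
  then obtain N where N: "\<And>i j. i \<ge> N \<Longrightarrow> j \<ge> N \<Longrightarrow> dist ((e \<circ> r) i) ((e \<circ> r) j) < 1"
    unfolding Cauchy_def by (meson zero_less_one)
  have "r (Suc N) \<noteq> r N" using assms(3) by (metis n_not_Suc_n strict_mono_eq)
  then have "cinner (e (r (Suc N))) (- e (r N)) = 0" using assms(1) by (simp add: cinner_simps)
  then have "(norm (e (r (Suc N)) + - e (r N)))\<^sup>2 = 2"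
    using norm_add_orthogonal[of "e (r (Suc N))" "- e (r N)"] by (simp add: assms(2))
  moreover have "norm (e (r (Suc N)) + - e (r N)) < 1" using N[of "Suc N" N] by (simp add: dist_norm)
  ultimately show False by (smt (verit, best) norm_ge_zero power_mono one_power2)
qed

section \<open>Bessel's inequality and maps between orthonormal families\<close>

lemma orthonormal0_norm_sum:
  assumes e: "orthonormal0 e" and "finite F"
  shows "(norm (\<Sum>k\<in>F. c k *\<^sub>C e k))\<^sup>2 = (\<Sum>k\<in>F. (cmod (c k) * norm (e k))\<^sup>2)"
  using assms(2)
proof (induction F rule: finite_induct)
  case (insert a F)
  have "cinner (e a) (e k) = 0" if "k \<in> F" for k
    using e insert.hyps that unfolding orthonormal0_def by metis
  then have "cinner (c a *\<^sub>C e a) (\<Sum>k\<in>F. c k *\<^sub>C e k) = 0"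
    unfolding cinner_sum_right by (intro sum.neutral) (simp add: cinner_simps)
  then show ?case using insert by (simp add: norm_add_orthogonal norm_scaleC)
qed simp

lemma orthonormal0_norm_le: "orthonormal0 e \<Longrightarrow> norm (e k) \<le> 1"
  unfolding orthonormal0_def by (metis norm_zero order_refl zero_le_one)

lemma bessel:
  assumes e: "orthonormal0 e"
  shows "(\<Sum>k<n. (cmod (cinner x (e k)))\<^sup>2) \<le> (norm x)\<^sup>2"
proof -
  let ?p = "\<Sum>k<n. cinner x (e k) *\<^sub>C e k"
  have ce: "cmod (cinner x (e k)) * norm (e k) = cmod (cinner x (e k))" for k
    using e unfolding orthonormal0_def by (metis cinner_zero_right mult.right_neutral mult_zero_left norm_zero)
  have "cinner ?p (e k) = cinner x (e k)" if "k < n" for k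
  proof -
    have "cinner ?p (e k) = (\<Sum>j<n. if j = k then cinner x (e k) else 0)"
      unfolding cinner_sum_left
      using e by (intro sum.cong) (auto simp: cinner_simps orthonormal0_mult_self orthonormal0_def)
    then show ?thesis using that by simp
  qed
  then have "cinner (x - ?p) ?p = 0"
    unfolding cinner_sum_right by (intro sum.neutral) (simp add: cinner_simps)
  then have "(norm x)\<^sup>2 = (norm (x - ?p))\<^sup>2 + (norm ?p)\<^sup>2"
    using norm_add_orthogonal[of "x - ?p" ?p] by simp
  moreover have "(norm ?p)\<^sup>2 = (\<Sum>k<n. (cmod (cinner x (e k)))\<^sup>2)"
    by (simp add: orthonormal0_norm_sum[OF e] ce)
  ultimately show ?thesis by simp
qed

text \<open>If both families are orthonormal and \<open>a\<close> is total, this is the isometry with \<open>a k \<mapsto> b k\<close>.\<close>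

definition basis_change :: "(nat \<Rightarrow> 'a::complex_inner) \<Rightarrow> (nat \<Rightarrow> 'b::complex_inner) \<Rightarrow> 'a \<Rightarrow> 'b" where
  "basis_change a b x = (\<Sum>k. cinner x (a k) *\<^sub>C b k)"

context
  fixes a :: "nat \<Rightarrow> 'a::complex_hilbert" and b :: "nat \<Rightarrow> 'b::complex_hilbert"
  assumes a: "orthonormal0 a" and b: "orthonormal0 b"
begin

lemma basis_change_partial_norm:
  assumes "finite F"
  shows "(norm (\<Sum>k\<in>F. cinner x (a k) *\<^sub>C b k))\<^sup>2 \<le> (\<Sum>k\<in>F. (cmod (cinner x (a k)))\<^sup>2)"
  unfolding orthonormal0_norm_sum[OF b assms]
  by (intro sum_mono power_mono mult_left_le orthonormal0_norm_le[OF b]) auto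

text \<open>The squared norms of blocks of the series are dominated by blocks of the Bessel series,
  which converges; completeness of the target does the rest.\<close>

lemma basis_change_sums: "(\<lambda>k. cinner x (a k) *\<^sub>C b k) sums basis_change a b x"
proof -
  have sq: "summable (\<lambda>k. (cmod (cinner x (a k)))\<^sup>2)"
    using bessel[OF a] by (intro summableI_nonneg_bounded[of _ "(norm x)\<^sup>2"]) auto
  have "summable (\<lambda>k. cinner x (a k) *\<^sub>C b k)"
    unfolding summable_Cauchy
  proof (intro allI impI)
    fix r :: real assume "r > 0"
    then obtain N where N: "\<And>m n. m \<ge> N \<Longrightarrow> norm (\<Sum>k=m..<n. (cmod (cinner x (a k)))\<^sup>2) < r\<^sup>2"
      using sq unfolding summable_Cauchy by (meson zero_less_power)
    have "norm (\<Sum>k=m..<n. cinner x (a k) *\<^sub>C b k) < r" if "m \<ge> N" for m n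
    proof (rule power2_less_imp_less)
      show "(norm (\<Sum>k=m..<n. cinner x (a k) *\<^sub>C b k))\<^sup>2 < r\<^sup>2"
        using basis_change_partial_norm[of "{m..<n}" x] N[OF that, of n] by auto
    qed (use \<open>r > 0\<close> in auto)
    then show "\<exists>N. \<forall>m\<ge>N. \<forall>n. norm (\<Sum>k=m..<n. cinner x (a k) *\<^sub>C b k) < r" by blast
  qed
  then show ?thesis unfolding basis_change_def by (rule summable_sums)
qed

lemma norm_basis_change_le: "norm (basis_change a b x) \<le> norm x"
proof (rule LIMSEQ_le_const2)
  show "(\<lambda>n. norm (\<Sum>k<n. cinner x (a k) *\<^sub>C b k)) \<longlonglongrightarrow> norm (basis_change a b x)"
    using basis_change_sums unfolding sums_def by (rule tendsto_norm)
  have "norm (\<Sum>k<n. cinner x (a k) *\<^sub>C b k) \<le> norm x" for n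
    by (rule power2_le_imp_le[OF order_trans[OF basis_change_partial_norm bessel[OF a]]]) auto
  then show "\<exists>N. \<forall>n\<ge>N. norm (\<Sum>k<n. cinner x (a k) *\<^sub>C b k) \<le> norm x" by blast
qed

lemma bounded_clinear_basis_change: "bounded_clinear (basis_change a b)"
proof -
  have add: "basis_change a b (x + y) = basis_change a b x + basis_change a b y" for x y
    using sums_add[OF basis_change_sums[of x] basis_change_sums[of y]] basis_change_sums[of "x + y"]
    by (simp add: cinner_simps scaleC_add_left sums_unique2)
  have scale: "basis_change a b (c *\<^sub>C x) = c *\<^sub>C basis_change a b x" for c x
    using bounded_linear.sums[OF bounded_linear_scaleC basis_change_sums[of x], of c]
      basis_change_sums[of "c *\<^sub>C x"]
    by (simp add: cinner_simps sums_unique2 flip: scaleC_scaleC)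
  have "bounded_linear (basis_change a b)"
  proof (rule bounded_linear_intro[of _ 1])
    show "basis_change a b (r *\<^sub>R x) = r *\<^sub>R basis_change a b x" for r x
      using scale by (metis scaleC_of_real)
  qed (use add norm_basis_change_le in auto)
  then show ?thesis using scale by (simp add: bounded_clinear_def)
qed

end

text \<open>Exchanging the two families gives the adjoint because the partial sums already satisfy
  the identity exactly.\<close>

lemma basis_change_adjoint:
  fixes a :: "nat \<Rightarrow> 'a::complex_hilbert" and b :: "nat \<Rightarrow> 'b::complex_hilbert"
  assumes a: "orthonormal0 a" and b: "orthonormal0 b"
  shows "cinner (basis_change a b x) y = cinner x (basis_change b a y)"
proof (rule LIMSEQ_unique)
  show "(\<lambda>n. cinner (\<Sum>k<n. cinner x (a k) *\<^sub>C b k) y) \<longlonglongrightarrow> cinner (basis_change a b x) y"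
    using basis_change_sums[OF a b, of x] unfolding sums_def by (intro tendsto_intros)
  have "(\<lambda>n. cinner x (\<Sum>k<n. cinner y (b k) *\<^sub>C a k)) \<longlonglongrightarrow> cinner x (basis_change b a y)"
    using basis_change_sums[OF b a, of y] unfolding sums_def by (intro tendsto_intros)
  moreover have "cinner x (\<Sum>k<n. cinner y (b k) *\<^sub>C a k) = cinner (\<Sum>k<n. cinner x (a k) *\<^sub>C b k) y" for n
    by (simp add: cinner_sum_left cinner_sum_right cinner_simps mult.commute flip: cinner_commute)
  ultimately show "(\<lambda>n. cinner (\<Sum>k<n. cinner x (a k) *\<^sub>C b k) y) \<longlonglongrightarrow> cinner x (basis_change b a y)"
    by simp
qed

text \<open>The factor \<open>cinner (a k) (a k)\<close> is 1, or 0 when \<open>a k\<close> is a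
  zero entry; in the second case it switches off \<open>b k\<close>.\<close>

lemma basis_change_basis:
  fixes a :: "nat \<Rightarrow> 'a::complex_hilbert" and b :: "nat \<Rightarrow> 'b::complex_hilbert"
  assumes a: "orthonormal0 a"
  shows "basis_change a b (a k) = cinner (a k) (a k) *\<^sub>C b k"
proof -
  have "basis_change a b (a k) = (\<Sum>j\<in>{k}. cinner (a k) (a j) *\<^sub>C b j)"
    unfolding basis_change_def using a by (intro suminf_finite) (auto simp: orthonormal0_def)
  then show ?thesis by simp
qed

text \<open>Both sides have the same coefficients in the total family \<open>a\<close>. Zero entries
  are tolerated in \<open>a\<close> but excluded in \<open>b\<close>, since a vanishing
  \<open>b k\<close> would lose the \<open>k\<close>-th coefficient.\<close>

lemma basis_change_inverse:
  fixes a :: "nat \<Rightarrow> 'a::complex_hilbert" and b :: "nat \<Rightarrow> 'b::complex_hilbert"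
  assumes a: "orthonormal0 a" and b: "orthonormal0 b" and b1: "\<And>k. norm (b k) = 1"
    and total: "\<And>x. (\<And>k. cinner x (a k) = 0) \<Longrightarrow> x = 0"
  shows "basis_change b a (basis_change a b x) = x"
proof -
  have "cinner (basis_change b a (basis_change a b x)) (a k) = cinner x (a k)" for k
  proof -
    have "cinner (basis_change b a (basis_change a b x)) (a k)
      = cinner x (basis_change b a (basis_change a b (a k)))"
      by (simp add: basis_change_adjoint a b)
    also have "basis_change a b (a k) = cinner (a k) (a k) *\<^sub>C b k" by (rule basis_change_basis[OF a])
    also have "basis_change b a \<dots> = cinner (a k) (a k) *\<^sub>C a k"
      using bounded_clinear_basis_change[OF b a] basis_change_basis[OF b, of a k]
      by (simp add: bounded_clinear_def cinner_self b1)
    finally show ?thesis by (simp add: orthonormal0_scaleC_self[OF a])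
  qed
  then have "basis_change b a (basis_change a b x) - x = 0"
    by (intro total) (simp add: cinner_simps)
  then show ?thesis by simp
qed

text \<open>Gram-Schmidt applied to an enumeration of a countable dense set: a vector orthogonal to
  every entry is orthogonal to the dense set, hence to itself.\<close>

lemma separable_total_orthonormal:
  assumes "separable_space (euclidean :: 'a::complex_hilbert topology)"
  obtains a :: "nat \<Rightarrow> 'a::complex_hilbert" where "orthonormal0 a" "\<And>x. (\<And>k. cinner x (a k) = 0) \<Longrightarrow> x = 0"
proof -
  obtain C :: "'a set" where C: "countable C" "closure C = UNIV"
    using assms unfolding separable_space_def by auto
  then have "C \<noteq> {}" by auto
  define a where "a = gram_schmidt (from_nat_into C)"
  have "x = 0" if "\<And>k. cinner x (a k) = 0" for x
  proof -
    have "complex_vector.span (a ` {..<Suc k}) \<subseteq> {y. cinner x y = 0}" for k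
      by (rule complex_vector.span_minimal)
        (auto simp: that complex_vector.subspace_def cinner_simps)
    then have "cinner x (from_nat_into C k) = 0" for k
      using in_span_gram_schmidt[of k "Suc k" "from_nat_into C"] unfolding a_def by auto
    then have o: "cinner x y = 0" if "y \<in> C" for y
      using from_nat_into_surj[OF C(1) that] by metis
    obtain f where f: "\<And>n. f n \<in> C" "f \<longlonglongrightarrow> x" using C(2) by (metis UNIV_I closure_sequential)
    have "(\<lambda>n. cinner x (f n)) \<longlonglongrightarrow> cinner x x" by (intro tendsto_intros f)
    then have "cinner x x = 0" using o f(1) by (simp add: LIMSEQ_const_iff)
    then show "x = 0" by simp
  qed
  moreover have "orthonormal0 a" unfolding a_def by (rule orthonormal0_gram_schmidt)
  ultimately show thesis using that[of a] by simp
qed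

section \<open>Self-adjoint operators and resolvents\<close>

lemma bounded_clinearD:
  assumes "bounded_clinear L"
  shows "bounded_linear L" "L (a *\<^sub>C x) = a *\<^sub>C L x" "L (x + y) = L x + L y"
    "L (x - y) = L x - L y" "L (r *\<^sub>R x) = r *\<^sub>R L x" "L 0 = 0" "L (- x) = - L x"
  using assms unfolding bounded_clinear_def
  by (auto simp: linear_add linear_diff linear_scale linear_0 linear_neg dest: bounded_linear.linear)

lemma linear_opD:
  assumes "linear_op T"
  shows "complex_vector.subspace (dom_of T)"
    "x \<in> dom_of T \<Longrightarrow> y \<in> dom_of T \<Longrightarrow> x + y \<in> dom_of T"
    "x \<in> dom_of T \<Longrightarrow> y \<in> dom_of T \<Longrightarrow> x - y \<in> dom_of T"
    "x \<in> dom_of T \<Longrightarrow> a *\<^sub>C x \<in> dom_of T"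
    "x \<in> dom_of T \<Longrightarrow> y \<in> dom_of T \<Longrightarrow> app T (x + y) = app T x + app T y"
    "x \<in> dom_of T \<Longrightarrow> app T (a *\<^sub>C x) = a *\<^sub>C app T x"
    "x \<in> dom_of T \<Longrightarrow> y \<in> dom_of T \<Longrightarrow> app T (x - y) = app T x - app T y"
    "0 \<in> dom_of T" "app T 0 = 0"
proof -
  show s: "complex_vector.subspace (dom_of T)" using assms by (simp add: linear_op_def)
  show add: "app T (x + y) = app T x + app T y" if "x \<in> dom_of T" "y \<in> dom_of T" for x y
    using assms that by (simp add: linear_op_def)
  show scale: "app T (a *\<^sub>C x) = a *\<^sub>C app T x" if "x \<in> dom_of T" for a x
    using assms that by (simp add: linear_op_def)
  show d: "x - y \<in> dom_of T" if "x \<in> dom_of T" "y \<in> dom_of T" for x y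
    using s that by (rule complex_vector.subspace_diff)
  show "app T (x - y) = app T x - app T y" if "x \<in> dom_of T" "y \<in> dom_of T"
    using add[OF d[OF that] that(2)] by simp
  show "x + y \<in> dom_of T" if "x \<in> dom_of T" "y \<in> dom_of T"
    using s that by (rule complex_vector.subspace_add)
  show "a *\<^sub>C x \<in> dom_of T" if "x \<in> dom_of T"
    using s that by (rule complex_vector.subspace_scale)
  show z: "0 \<in> dom_of T" using s by (rule complex_vector.subspace_0)
  show "app T 0 = 0" using scale[OF z, of 0] by simp
qed

section \<open>The adjoint relation and self-adjointness\<close>

lemma adjoint_unique:
  fixes T :: "'a::complex_hilbert unbounded_op"
  assumes T: "linear_op T" "densely_defined T"
    and "\<forall>x\<in>dom_of T. cinner (app T x) y = cinner x z" "\<forall>x\<in>dom_of T. cinner (app T x) y = cinner x z'"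
  shows "z = z'"
proof -
  have "\<forall>x\<in>dom_of T. cinner (z - z') x = 0"
    using assms(3,4) by (metis cinner_diff_right cinner_zero_commute eq_iff_diff_eq_0)
  then show ?thesis
    using dense_iff_orthogonal[OF linear_opD(1)[OF T(1)]] T(2)
    unfolding densely_defined_def by (metis eq_iff_diff_eq_0)
qed

text \<open>Graph form of self-adjointness: the definite description is replaced by a relation
  between \<open>y\<close> and \<open>z\<close> that survives limits, so that closedness arguments
  need no separate treatment of the domain.\<close>

lemma self_adjoint_iff:
  fixes T :: "'a::complex_hilbert unbounded_op"
  shows "self_adjoint T \<longleftrightarrow> linear_op T \<and> densely_defined T \<and>
    (\<forall>y z. (\<forall>x\<in>dom_of T. cinner (app T x) y = cinner x z) \<longleftrightarrow> y \<in> dom_of T \<and> app T y = z)"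
    (is "_ \<longleftrightarrow> _ \<and> _ \<and> ?C")
proof -
  have "same_op T (adjoint_op T) \<longleftrightarrow> ?C" if T: "linear_op T" "densely_defined T"
  proof -
    let ?P = "\<lambda>y z. \<forall>x\<in>dom_of T. cinner (app T x) y = cinner x z"
    have the: "(THE z. ?P y z) = z" if "?P y z" for y z
      using that adjoint_unique[OF T] by (intro the_equality) blast+
    show ?thesis
    proof
      assume s: "same_op T (adjoint_op T)"
      have dom: "y \<in> dom_of T \<longleftrightarrow> (\<exists>z. ?P y z)" for y
        using s unfolding same_op_def adjoint_op_def unbounded_op.sel by blast
      have val: "app T y = (THE z. ?P y z)" if "y \<in> dom_of T" for y
        using s that unfolding same_op_def adjoint_op_def unbounded_op.sel by blast
      show ?C
      proof (intro allI iffI)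
        fix y z assume P: "?P y z"
        have "y \<in> dom_of T" unfolding dom using P by (rule exI)
        then show "y \<in> dom_of T \<and> app T y = z" using val the[OF P] by metis
      next
        fix y z assume y: "y \<in> dom_of T \<and> app T y = z"
        then obtain z' where P: "?P y z'" using dom[of y] by blast
        have "z = z'" using y val[of y] the[OF P] by metis
        then show "?P y z" using P by metis
      qed
    next
      assume c: ?C
      have "y \<in> dom_of T \<longleftrightarrow> (\<exists>z. ?P y z)" for y using c by blast
      moreover have "app T y = (THE z. ?P y z)" if "y \<in> dom_of T" for y
      proof -
        have "?P y (app T y)" using c that by blast
        from the[OF this] show ?thesis by (rule sym)
      qed
      ultimately show "same_op T (adjoint_op T)"
        unfolding same_op_def adjoint_op_def unbounded_op.sel by blast
    qed
  qed
  then show ?thesis unfolding self_adjoint_def by blast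
qed

lemma self_adjointD:
  fixes T :: "'a::complex_hilbert unbounded_op"
  assumes "self_adjoint T"
  shows "linear_op T"
    "x \<in> dom_of T \<Longrightarrow> y \<in> dom_of T \<Longrightarrow> cinner (app T x) y = cinner x (app T y)"
    "(\<And>x. x \<in> dom_of T \<Longrightarrow> cinner (app T x) y = cinner x z) \<Longrightarrow> y \<in> dom_of T"
    "(\<And>x. x \<in> dom_of T \<Longrightarrow> cinner (app T x) y = cinner x z) \<Longrightarrow> app T y = z"
  using assms unfolding self_adjoint_iff by blast+

text \<open>Boundedness of the inverse becomes a lower bound for \<open>T - z\<close>. Such bounds
  can be moved between operators without mentioning their resolvents.\<close>

lemma in_resolvent_set_iff:
  fixes T :: "'a::complex_inner unbounded_op"
  assumes T: "linear_op T"
  shows "z \<in> resolvent_set T \<longleftrightarrow> bij_betw (\<lambda>x. app T x - z *\<^sub>C x) (dom_of T) UNIV \<and>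
    (\<exists>c>0. \<forall>x\<in>dom_of T. c * norm x \<le> norm (app T x - z *\<^sub>C x))"
proof -
  let ?f = "\<lambda>x. app T x - z *\<^sub>C x"
  have "bounded_linear (resolvent T z) \<longleftrightarrow> (\<exists>c>0. \<forall>x\<in>dom_of T. c * norm x \<le> norm (?f x))"
    if bij: "bij_betw ?f (dom_of T) UNIV"
  proof
    have inv: "resolvent T z (?f x) = x" if "x \<in> dom_of T" for x
      unfolding resolvent_def using bij inv_into_f_f[of ?f "dom_of T" x] that by (simp add: bij_betw_def)
    have dom: "resolvent T z y \<in> dom_of T" for y
      unfolding resolvent_def using bij by (metis UNIV_I bij_betw_def inv_into_into)
    have res: "?f (resolvent T z y) = y" for y
      unfolding resolvent_def using bij f_inv_into_f[of y ?f "dom_of T"] by (simp add: bij_betw_def)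
    {
      assume "bounded_linear (resolvent T z)"
      then obtain K where K: "K > 0" "\<And>y. norm (resolvent T z y) \<le> norm y * K"
        using bounded_linear.pos_bounded by blast
      have "1 / K * norm x \<le> norm (?f x)" if "x \<in> dom_of T" for x
        using K(2)[of "?f x"] K(1) inv[OF that] by (simp add: field_simps)
      then show "\<exists>c>0. \<forall>x\<in>dom_of T. c * norm x \<le> norm (?f x)"
        using K(1) by (intro exI[of _ "1 / K"]) simp
    next
      assume "\<exists>c>0. \<forall>x\<in>dom_of T. c * norm x \<le> norm (?f x)"
      then obtain c where c: "c > 0" "\<And>x. x \<in> dom_of T \<Longrightarrow> c * norm x \<le> norm (?f x)" by blast
      show "bounded_linear (resolvent T z)"
      proof (rule bounded_linear_intro[of _ "1 / c"])
        fix x y and r :: real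
        have "?f (resolvent T z x + resolvent T z y) = ?f (resolvent T z x) + ?f (resolvent T z y)"
          by (simp add: linear_opD[OF T] dom scaleC_add_right)
        then show "resolvent T z (x + y) = resolvent T z x + resolvent T z y"
          using inv[OF linear_opD(2)[OF T dom dom], of x y] by (simp add: res)
        have "?f (of_real r *\<^sub>C resolvent T z x) = of_real r *\<^sub>C ?f (resolvent T z x)"
          by (simp add: linear_opD[OF T] dom scaleC_diff_right scaleC_scaleC mult.commute)
        then show "resolvent T z (r *\<^sub>R x) = r *\<^sub>R resolvent T z x"
          using inv[OF linear_opD(4)[OF T dom], of "of_real r" x] by (simp add: res scaleC_of_real)
        show "norm (resolvent T z x) \<le> norm x * (1 / c)"
          using c(2)[OF dom, of x] c(1) by (simp add: res field_simps)
      qed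
    }
  qed
  then show ?thesis unfolding resolvent_set_def by blast
qed

lemma resolventD:
  fixes T :: "'a::complex_inner unbounded_op"
  assumes "z \<in> resolvent_set T"
  shows "resolvent T z y \<in> dom_of T"
    and "app T (resolvent T z y) = y + z *\<^sub>C resolvent T z y"
    and "x \<in> dom_of T \<Longrightarrow> resolvent T z (app T x - z *\<^sub>C x) = x"
    and "bounded_linear (resolvent T z)"
proof -
  let ?f = "\<lambda>x. app T x - z *\<^sub>C x"
  have bij: "bij_betw ?f (dom_of T) UNIV" and "bounded_linear (resolvent T z)"
    using assms by (auto simp: resolvent_set_def)
  then show "bounded_linear (resolvent T z)" by simp
  show "resolvent T z (?f x) = x" if "x \<in> dom_of T" for x
    unfolding resolvent_def using bij inv_into_f_f[of ?f "dom_of T" x] that by (simp add: bij_betw_def)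
  show "resolvent T z y \<in> dom_of T" for y
    unfolding resolvent_def using bij by (metis UNIV_I bij_betw_def inv_into_into)
  have "?f (resolvent T z y) = y"
    unfolding resolvent_def using bij f_inv_into_f[of y ?f "dom_of T"] by (simp add: bij_betw_def)
  then show "app T (resolvent T z y) = y + z *\<^sub>C resolvent T z y" by (simp add: algebra_simps)
qed

lemma bounded_clinear_resolvent:
  fixes T :: "'a::complex_inner unbounded_op"
  assumes T: "linear_op T" and z: "z \<in> resolvent_set T"
  shows "bounded_clinear (resolvent T z)"
  unfolding bounded_clinear_def
proof (intro conjI allI resolventD(4)[OF z])
  fix a x
  note d = resolventD[OF z]
  have "app T (a *\<^sub>C resolvent T z x) - z *\<^sub>C (a *\<^sub>C resolvent T z x) = a *\<^sub>C x"
    by (simp add: linear_opD[OF T] d scaleC_add_right scaleC_scaleC mult.commute)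
  then show "resolvent T z (a *\<^sub>C x) = a *\<^sub>C resolvent T z x"
    using d(3)[OF linear_opD(4)[OF T d(1)], of a x] by simp
qed

text \<open>The range of \<open>T - z\<close> is closed by the lower bound, and its orthogonal complement is
  the kernel of \<open>T - cnj z\<close>.\<close>

lemma self_adjoint_in_resolvent_set:
  fixes T :: "'a::complex_hilbert unbounded_op"
  assumes T: "self_adjoint T" and c: "c > 0"
    and lower: "\<And>x. x \<in> dom_of T \<Longrightarrow> c * norm x \<le> norm (app T x - z *\<^sub>C x)"
    and ker: "\<And>x. x \<in> dom_of T \<Longrightarrow> app T x = cnj z *\<^sub>C x \<Longrightarrow> x = 0"
  shows "z \<in> resolvent_set T"
proof -
  let ?f = "\<lambda>x. app T x - z *\<^sub>C x"
  note lin = linear_opD[OF self_adjointD(1)[OF T]]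
  have fdiff: "?f (x - y) = ?f x - ?f y" if "x \<in> dom_of T" "y \<in> dom_of T" for x y
    using that by (simp add: lin scaleC_diff_right)
  have inj: "inj_on ?f (dom_of T)"
  proof (rule inj_onI)
    fix x y assume xy: "x \<in> dom_of T" "y \<in> dom_of T" "?f x = ?f y"
    then have "c * norm (x - y) \<le> 0" using lower[OF lin(3)[OF xy(1,2)]] fdiff[OF xy(1,2)] by simp
    then show "x = y" using c by (simp add: mult_le_0_iff)
  qed
  let ?M = "?f ` dom_of T"
  have sub: "complex_vector.subspace ?M"
  proof (rule complex_vector.subspaceI)
    show "0 \<in> ?M" using lin(8,9) by (intro image_eqI[of _ _ 0]) auto
    show "u + v \<in> ?M" if uv: "u \<in> ?M" "v \<in> ?M" for u v
    proof -
      obtain x y where "x \<in> dom_of T" "y \<in> dom_of T" "u = ?f x" "v = ?f y" using uv by blast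
      then show ?thesis by (intro image_eqI[of _ _ "x + y"]) (auto simp: lin scaleC_add_right)
    qed
    show "a *\<^sub>C u \<in> ?M" if u: "u \<in> ?M" for a u
    proof -
      obtain x where "x \<in> dom_of T" "u = ?f x" using u by blast
      then show ?thesis
        by (intro image_eqI[of _ _ "a *\<^sub>C x"]) (auto simp: lin scaleC_diff_right scaleC_scaleC mult.commute)
    qed
  qed
  have "closed ?M"
    unfolding closed_sequential_limits
  proof (intro allI impI, elim conjE)
    fix u l assume u: "\<forall>n. u n \<in> ?M" and ul: "u \<longlonglongrightarrow> l"
    have "\<exists>x. x \<in> dom_of T \<and> u n = ?f x" for n
      using spec[OF u, of n] by (elim imageE) blast
    then have "\<exists>x. \<forall>n. x n \<in> dom_of T \<and> u n = ?f (x n)" by (intro choice allI)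
    then obtain x where x: "\<And>n. x n \<in> dom_of T" "\<And>n. u n = ?f (x n)" by blast
    have "Cauchy x"
    proof (rule metric_CauchyI)
      fix e :: real assume "e > 0"
      then have "c * e > 0" using c by simp
      then obtain N where N: "\<And>m n. m \<ge> N \<Longrightarrow> n \<ge> N \<Longrightarrow> dist (u m) (u n) < c * e"
        using LIMSEQ_imp_Cauchy[OF ul] unfolding Cauchy_def by blast
      have "dist (x m) (x n) < e" if "m \<ge> N" "n \<ge> N" for m n
      proof -
        have "c * norm (x m - x n) \<le> dist (u m) (u n)"
          using lower[OF lin(3)[OF x(1) x(1)], of m n] by (simp add: x(2) dist_norm fdiff x(1))
        also have "\<dots> < c * e" using N that by blast
        finally show ?thesis using c by (simp add: dist_norm)
      qed
      then show "\<exists>N. \<forall>m\<ge>N. \<forall>n\<ge>N. dist (x m) (x n) < e" by blast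
    qed
    then obtain y where y: "x \<longlonglongrightarrow> y" by (meson Cauchy_convergent convergent_def)
    have "(\<lambda>n. u n + z *\<^sub>C x n) \<longlonglongrightarrow> l + z *\<^sub>C y" by (intro tendsto_intros ul y)
    then have Tx: "(\<lambda>n. app T (x n)) \<longlonglongrightarrow> l + z *\<^sub>C y" by (simp add: x(2))
    \<comment> \<open>Closedness of \<open>T\<close> in disguise: the limit satisfies the adjoint
      relation, and self-adjointness turns this into membership in the domain together with the
      value.\<close>
    have "cinner (app T w) y = cinner w (l + z *\<^sub>C y)" if "w \<in> dom_of T" for w
    proof (rule LIMSEQ_unique)
      show "(\<lambda>n. cinner (app T w) (x n)) \<longlonglongrightarrow> cinner (app T w) y" by (intro tendsto_intros y)
      show "(\<lambda>n. cinner (app T w) (x n)) \<longlonglongrightarrow> cinner w (l + z *\<^sub>C y)"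
        unfolding self_adjointD(2)[OF T that x(1)] by (intro tendsto_intros Tx)
    qed
    then have "y \<in> dom_of T" "app T y = l + z *\<^sub>C y"
      using self_adjointD(3,4)[OF T] by blast+
    then show "l \<in> ?M" by (intro image_eqI[of _ _ y]) auto
  qed
  have "y \<in> ?M" for y
  proof -
    obtain m where m: "m \<in> ?M" "\<And>u. u \<in> ?M \<Longrightarrow> cinner (y - m) u = 0"
      using orthogonal_projection[OF sub \<open>closed ?M\<close>] by blast
    let ?u = "y - m"
    have o: "cinner (app T x) ?u = cinner x (cnj z *\<^sub>C ?u)" if "x \<in> dom_of T" for x
    proof -
      have "cinner (?f x) ?u = 0" using m(2)[of "?f x"] that by (simp add: cinner_zero_commute)
      then show ?thesis by (simp add: cinner_simps algebra_simps)
    qed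
    have "?u = 0"
      by (rule ker[OF self_adjointD(3)[OF T o] self_adjointD(4)[OF T o]])
    then show ?thesis using m(1) by simp
  qed
  then have "bij_betw ?f (dom_of T) UNIV" using inj by (auto simp: bij_betw_def)
  then show ?thesis using lower c in_resolvent_set_iff[OF self_adjointD(1)[OF T]] by blast
qed

text \<open>Since \<open>cinner y x\<close> is real, the imaginary part of
  \<open>cinner (y - z *\<^sub>C x) x\<close> only sees \<open>Im z\<close>.\<close>

lemma symmetric_nonreal_lower_bound:
  fixes x :: "'a::complex_inner"
  assumes "cinner y x = cinner x y"
  shows "\<bar>Im z\<bar> * norm x \<le> norm (y - z *\<^sub>C x)"
proof (cases "x = 0")
  case False
  have "Im (cinner y x) = 0"
    using assms cinner_commute[of x y] by (simp add: complex_eq_iff)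
  then have "Im (cinner (y - z *\<^sub>C x) x) = - Im z * (norm x)\<^sup>2"
    by (simp add: cinner_simps cinner_self)
  then have "\<bar>Im z\<bar> * (norm x)\<^sup>2 \<le> cmod (cinner (y - z *\<^sub>C x) x)"
    using abs_Im_le_cmod[of "cinner (y - z *\<^sub>C x) x"] by (simp add: abs_mult)
  also have "\<dots> \<le> norm (y - z *\<^sub>C x) * norm x" by (rule cinner_cauchy_schwarz)
  finally show ?thesis using False by (simp add: power2_eq_square)
qed simp

lemma self_adjoint_nonreal:
  fixes T :: "'a::complex_hilbert unbounded_op"
  assumes T: "self_adjoint T" and z: "Im z \<noteq> 0"
  shows "z \<in> resolvent_set T"
proof (rule self_adjoint_in_resolvent_set[OF T, of "\<bar>Im z\<bar>"])
  have lower: "\<bar>Im w\<bar> * norm x \<le> norm (app T x - w *\<^sub>C x)" if "x \<in> dom_of T" for x w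
    by (rule symmetric_nonreal_lower_bound) (simp add: self_adjointD(2)[OF T] that)
  then show "\<bar>Im z\<bar> * norm x \<le> norm (app T x - z *\<^sub>C x)" if "x \<in> dom_of T" for x
    using that by blast
  show "x = 0" if "x \<in> dom_of T" "app T x = cnj z *\<^sub>C x" for x
    using lower[OF that(1), of "cnj z"] that(2) z by (simp add: mult_le_0_iff)
qed (use z in auto)

definition sa_map :: "('a::complex_inner \<Rightarrow> 'a) \<Rightarrow> bool" where
  "sa_map B \<longleftrightarrow> bounded_clinear B \<and> (\<forall>x y. cinner (B x) y = cinner x (B y))"

lemma sa_mapD:
  assumes "sa_map B"
  shows "bounded_clinear B" "cinner (B x) y = cinner x (B y)"
  using assms by (auto simp: sa_map_def)

text \<open>Symmetry of \<open>T\<close> is tested on two vectors in the range of the resolvent; the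
  two terms containing \<open>r\<close> cancel because \<open>r\<close> is real.\<close>

lemma sa_map_resolvent:
  fixes T :: "'a::complex_hilbert unbounded_op"
  assumes T: "self_adjoint T" and r: "of_real r \<in> resolvent_set T"
  shows "sa_map (resolvent T (of_real r))"
  unfolding sa_map_def
proof (intro conjI allI)
  show "bounded_clinear (resolvent T (of_real r))"
    using bounded_clinear_resolvent[OF self_adjointD(1)[OF T] r] .
  fix x y
  let ?R = "resolvent T (of_real r)"
  have "cinner (app T (?R x)) (?R y) = cinner (?R x) (app T (?R y))"
    by (intro self_adjointD(2)[OF T] resolventD(1)[OF r])
  then show "cinner (?R x) y = cinner x (?R y)"
    by (simp add: resolventD(2)[OF r] cinner_simps)
qed

lemma self_adjoint_sa_map:
  fixes B :: "'a::complex_hilbert \<Rightarrow> 'a"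
  assumes "sa_map B"
  shows "self_adjoint (Op UNIV B)"
  unfolding self_adjoint_iff
proof (intro conjI allI)
  show "linear_op (Op UNIV B)"
    using bounded_clinearD[OF sa_mapD(1)[OF assms]] by (simp add: linear_op_def)
  show "densely_defined (Op UNIV B)" by (simp add: densely_defined_def)
  fix y z
  have "B y = z" if "\<forall>x. cinner x (B y) = cinner x z"
  proof -
    have "cinner (B y - z) (B y - z) = 0" using that by (simp add: cinner_simps)
    then show ?thesis by simp
  qed
  then show "(\<forall>x\<in>dom_of (Op UNIV B). cinner (app (Op UNIV B) x) y = cinner x z)
    \<longleftrightarrow> y \<in> dom_of (Op UNIV B) \<and> app (Op UNIV B) y = z"
    by (auto simp: sa_mapD(2)[OF assms])
qed

section \<open>Bounded self-adjoint operators\<close>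

definition bounded_below :: "('a::real_normed_vector \<Rightarrow> 'b::real_normed_vector) \<Rightarrow> bool" where
  "bounded_below L \<longleftrightarrow> (\<exists>c>0. \<forall>x. c * norm x \<le> norm (L x))"

lemma bounded_below_comp:
  assumes "bounded_below L" "bounded_below M"
  shows "bounded_below (\<lambda>x. L (M x))"
proof -
  obtain c d where c: "c > 0" "\<And>x. c * norm x \<le> norm (L x)" and d: "d > 0" "\<And>x. d * norm x \<le> norm (M x)"
    using assms unfolding bounded_below_def by blast
  have "(c * d) * norm x \<le> norm (L (M x))" for x
  proof -
    have "c * (d * norm x) \<le> c * norm (M x)" using c(1) d(2) by (intro mult_left_mono) auto
    also have "\<dots> \<le> norm (L (M x))" by (rule c(2))
    finally show ?thesis by (simp add: mult.assoc)
  qed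
  then show ?thesis unfolding bounded_below_def using c(1) d(1) by (meson mult_pos_pos)
qed

text \<open>The norm of a bounded self-adjoint operator is its spectral radius: if \<open>M < m = onorm C\<close>,
  then \<open>norm ((C - m) ((C + m) x))\<close> bounds \<open>norm (C x)\<close> away from \<open>m * norm x\<close>.\<close>

lemma sa_map_norm_bound:
  fixes C :: "'a::complex_hilbert \<Rightarrow> 'a"
  assumes C: "sa_map C" and "M \<ge> 0"
    and below: "\<And>s::real. \<bar>s\<bar> > M \<Longrightarrow> bounded_below (\<lambda>x. C x - s *\<^sub>R x)"
  shows "norm (C x) \<le> M * norm x"
proof -
  note lin = bounded_clinearD[OF sa_mapD(1)[OF C]]
  define m where "m = onorm C"
  have le: "norm (C x) \<le> m * norm x" for x unfolding m_def by (rule onorm[OF lin(1)])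
  have "m \<le> M"
  proof (rule ccontr)
    assume "\<not> m \<le> M"
    then have mM: "m > M" and m0: "m > 0" using assms(2) by auto
    have "bounded_below (\<lambda>x. C (C x - (- m) *\<^sub>R x) - m *\<^sub>R (C x - (- m) *\<^sub>R x))"
      by (rule bounded_below_comp[OF below[of m] below[of "- m"]]) (use mM m0 in auto)
    then obtain k where k: "k > 0"
      "\<And>x. k * norm x \<le> norm (C (C x - (- m) *\<^sub>R x) - m *\<^sub>R (C x - (- m) *\<^sub>R x))"
      unfolding bounded_below_def by blast
    \<comment> \<open>The estimates below give \<open>(k * norm x)^2 \<le> m^2 * (m^2 * (norm x)^2 -
      (norm (C x))^2)\<close>; solving for \<open>norm (C x)\<close> yields \<open>q\<close>. The
      \<open>max\<close> keeps the radicand nonnegative.\<close>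
    define q where "q = sqrt (max 0 (m\<^sup>2 - (k / m)\<^sup>2))"
    have qm: "q < m"
      unfolding q_def using m0 k(1) by (intro real_less_lsqrt) auto
    have "norm (C x) \<le> norm x * q" for x
    proof -
      have e: "C (C x - (- m) *\<^sub>R x) - m *\<^sub>R (C x - (- m) *\<^sub>R x) = C (C x) - m\<^sup>2 *\<^sub>R x"
        by (simp add: lin power2_eq_square scaleR_add_right)
      have "(k * norm x)\<^sup>2 \<le> (norm (C (C x) - m\<^sup>2 *\<^sub>R x))\<^sup>2"
        using k(2)[of x] k(1) unfolding e by (intro power_mono) auto
      also have "\<dots> = (norm (C (C x)))\<^sup>2 - 2 * m\<^sup>2 * (norm (C x))\<^sup>2 + (m\<^sup>2)\<^sup>2 * (norm x)\<^sup>2"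
      proof -
        have "cinner (C (C x)) x = cinner (C x) (C x)" "cinner x (C (C x)) = cinner (C x) (C x)"
          using sa_mapD(2)[OF C] by metis+
        then show ?thesis
          unfolding norm_eq_cinner[of "C (C x) - _"] cinner_diff_left cinner_diff_right
            cinner_scaleR_left cinner_scaleR_right
          by (simp add: cinner_self power2_eq_square algebra_simps)
      qed
      also have "(norm (C (C x)))\<^sup>2 \<le> (m * norm (C x))\<^sup>2" using le[of "C x"] by (intro power_mono) auto
      finally have "(k * norm x)\<^sup>2 \<le> m\<^sup>2 * (m\<^sup>2 * (norm x)\<^sup>2 - (norm (C x))\<^sup>2)"
        by (simp add: power_mult_distrib algebra_simps power2_eq_square)
      then have "(norm (C x))\<^sup>2 \<le> (m\<^sup>2 - (k / m)\<^sup>2) * (norm x)\<^sup>2"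
        using m0 by (simp add: power_divide power_mult_distrib field_simps)
      also have "\<dots> \<le> max 0 (m\<^sup>2 - (k / m)\<^sup>2) * (norm x)\<^sup>2" by (intro mult_right_mono) auto
      also have "\<dots> = (norm x * q)\<^sup>2" unfolding q_def by (simp add: power_mult_distrib)
      finally show ?thesis by (rule power2_le_imp_le) (simp add: q_def)
    qed
    then have "onorm C \<le> q" by (intro onorm_bound) (auto simp: q_def mult.commute)
    then show False using qm by (simp add: m_def)
  qed
  then show ?thesis using le[of x] by (meson mult_right_mono norm_ge_zero order_trans)
qed

lemma sa_map_in_resolvent_set_iff:
  fixes B :: "'a::complex_hilbert \<Rightarrow> 'a"
  assumes "sa_map B"
  shows "z \<in> resolvent_set (Op UNIV B) \<longleftrightarrow>
    bij (\<lambda>x. B x - z *\<^sub>C x) \<and> bounded_below (\<lambda>x. B x - z *\<^sub>C x)"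
  using in_resolvent_set_iff[OF self_adjointD(1)[OF self_adjoint_sa_map[OF assms]]]
  by (simp add: bounded_below_def)

text \<open>A gap of the spectrum around \<open>0\<close>: for \<open>0 < \<epsilon> < \<delta> / 2\<close> the operator
  \<open>C = (T - \<epsilon>)\<^sup>-\<^sup>1 + (T + \<epsilon>)\<^sup>-\<^sup>1\<close> satisfies \<open>C (T\<^sup>2 - \<epsilon>\<^sup>2) = 2 T\<close>. If \<open>s\<close> is in its spectrum, then a root of
  \<open>s (t\<^sup>2 - \<epsilon>\<^sup>2) = 2 t\<close> is in the spectrum of \<open>T\<close>; these roots are nonzero and lie within
  \<open>2 / \<bar>s\<bar> + \<epsilon>\<close> of \<open>0\<close>. Hence \<open>norm C \<le> 4 / \<delta>\<close>, uniformly in \<open>\<epsilon>\<close>.\<close>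

lemma spectral_gap_bound:
  fixes T :: "'a::complex_hilbert \<Rightarrow> 'a"
  assumes T: "sa_map T" and "\<delta> > 0"
    and gap: "\<And>t::real. t \<noteq> 0 \<Longrightarrow> \<bar>t\<bar> < \<delta> \<Longrightarrow> of_real t \<in> resolvent_set (Op UNIV T)"
  shows "\<delta> * norm (T x) \<le> 2 * norm (T (T x))"
proof -
  note lin = bounded_clinearD[OF sa_mapD(1)[OF T]]
  have below: "bounded_below (\<lambda>x. T x - t *\<^sub>R x)" if "t \<noteq> 0" "\<bar>t\<bar> < \<delta>" for t
    using gap[OF that] by (simp add: sa_map_in_resolvent_set_iff[OF T] scaleC_of_real)
  have step: "\<delta> * norm (T u) \<le> 2 * norm (T (T u) - \<epsilon>\<^sup>2 *\<^sub>R u)" if \<epsilon>: "0 < \<epsilon>" "\<epsilon> < \<delta> / 2" for \<epsilon> u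
  proof -
    have e: "of_real \<epsilon> \<in> resolvent_set (Op UNIV T)" "of_real (- \<epsilon>) \<in> resolvent_set (Op UNIV T)"
      using \<epsilon> by (intro gap; simp)+
    define P where "P = resolvent (Op UNIV T) (of_real \<epsilon>)"
    define N where "N = resolvent (Op UNIV T) (of_real (- \<epsilon>))"
    have saP: "sa_map P" and saN: "sa_map N"
      unfolding P_def N_def
      using sa_map_resolvent[OF self_adjoint_sa_map[OF T]] e by blast+
    \<comment> \<open>Corresponds to the function \<open>2 t / (t^2 - \<epsilon>^2)\<close>, which
      vanishes at \<open>t = 0\<close>. Hence the kernel of \<open>T\<close> does not contribute to
      the norm of \<open>C\<close>, whereas on it each summand alone has size
      \<open>1 / \<epsilon>\<close>.\<close>
    define C where "C = (\<lambda>x. P x + N x)"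
    have saC: "sa_map C"
      using saP saN unfolding sa_map_def bounded_clinear_def C_def
      by (simp add: cinner_simps scaleC_add_right bounded_linear_add)
    have Pinv: "P (T w - \<epsilon> *\<^sub>R w) = w" for w
      using resolventD(3)[OF e(1), of w] by (simp add: P_def scaleC_of_real)
    have Ninv: "N (T w + \<epsilon> *\<^sub>R w) = w" for w
      using resolventD(3)[OF e(2), of w] by (simp add: N_def scaleC_of_real del: of_real_minus)
    have CT: "C (T (T w) - \<epsilon>\<^sup>2 *\<^sub>R w) = 2 *\<^sub>R T w" for w
    proof -
      have "T (T w) - \<epsilon>\<^sup>2 *\<^sub>R w = T (T w + \<epsilon> *\<^sub>R w) - \<epsilon> *\<^sub>R (T w + \<epsilon> *\<^sub>R w)"
        "T (T w) - \<epsilon>\<^sup>2 *\<^sub>R w = T (T w - \<epsilon> *\<^sub>R w) + \<epsilon> *\<^sub>R (T w - \<epsilon> *\<^sub>R w)"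
        by (simp_all add: lin power2_eq_square scaleR_add_right scaleR_diff_right)
      then have "C (T (T w) - \<epsilon>\<^sup>2 *\<^sub>R w) = (T w + \<epsilon> *\<^sub>R w) + (T w - \<epsilon> *\<^sub>R w)"
        unfolding C_def by (metis Pinv Ninv)
      then show ?thesis by (simp add: scaleR_2)
    qed
    have surj: "\<exists>w. x = T (T w) - \<epsilon>\<^sup>2 *\<^sub>R w" for x
    proof -
      have "x = T (P x) - \<epsilon> *\<^sub>R P x" for x
        using resolventD(2)[OF e(1), of x] by (simp add: P_def scaleC_of_real)
      moreover have "x = T (N x) + \<epsilon> *\<^sub>R N x" for x
        using resolventD(2)[OF e(2), of x] by (simp add: N_def scaleC_of_real del: of_real_minus)
      ultimately have "x = T (T (N (P x)) + \<epsilon> *\<^sub>R N (P x)) - \<epsilon> *\<^sub>R (T (N (P x)) + \<epsilon> *\<^sub>R N (P x))"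
        by metis
      then show ?thesis
        by (intro exI[of _ "N (P x)"]) (simp add: lin power2_eq_square scaleR_add_right)
    qed
    have "norm (C x) \<le> 4 / \<delta> * norm x" for x
    proof (rule sa_map_norm_bound[OF saC])
      fix s :: real assume s: "\<bar>s\<bar> > 4 / \<delta>"
      then have s0: "s \<noteq> 0" using \<open>\<delta> > 0\<close> by (auto simp: field_simps)
      \<comment> \<open>Quadratic formula for \<open>s t^2 - 2 t - s \<epsilon>^2 = 0\<close>. The
        product of the roots is \<open>- \<epsilon>^2\<close>, so neither is 0, the only point near
        0 about which \<open>gap\<close> is silent. The threshold \<open>4 / \<delta>\<close> makes
        \<open>2 / \<bar>s\<bar>\<close> less than \<open>\<delta> / 2\<close> and leaves the other
        half to \<epsilon>.\<close>
      define d where "d = sqrt (1 + s\<^sup>2 * \<epsilon>\<^sup>2)"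
      define t1 where "t1 = (1 + d) / s"
      define t2 where "t2 = (1 - d) / s"
      have d2: "d\<^sup>2 = 1 + s\<^sup>2 * \<epsilon>\<^sup>2" unfolding d_def by simp
      have sum: "s * (t1 + t2) = 2" unfolding t1_def t2_def using s0 by (simp add: field_simps)
      have "s\<^sup>2 * (t1 * t2) = 1 - d\<^sup>2"
        unfolding t1_def t2_def using s0 by (simp add: field_simps power2_eq_square)
      then have "s\<^sup>2 * (t1 * t2) = s\<^sup>2 * (- \<epsilon>\<^sup>2)" unfolding d2 by simp
      then have prod: "t1 * t2 = - \<epsilon>\<^sup>2"
        unfolding mult_cancel_left using s0 by simp
      then have t0: "t1 \<noteq> 0" "t2 \<noteq> 0" using \<epsilon>(1) by auto
      have "d \<ge> 0" unfolding d_def by simp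
      have "d \<le> 1 + \<bar>s\<bar> * \<epsilon>"
        unfolding d_def using \<epsilon>(1) by (intro real_le_lsqrt) (auto simp: power2_sum power_mult_distrib)
      then have "(1 + d) / \<bar>s\<bar> \<le> (2 + \<bar>s\<bar> * \<epsilon>) / \<bar>s\<bar>"
        by (intro divide_right_mono) auto
      also have "\<dots> = 2 / \<bar>s\<bar> + \<epsilon>" using s0 by (simp add: add_divide_distrib)
      also have "2 / \<bar>s\<bar> + \<epsilon> < \<delta>"
      proof -
        have "2 / \<bar>s\<bar> < \<delta> / 2" using s \<open>\<delta> > 0\<close> s0 by (simp add: field_simps)
        then show ?thesis using \<epsilon>(2) by simp
      qed
      finally have "(1 + d) / \<bar>s\<bar> < \<delta>" .
      then have t: "\<bar>t1\<bar> < \<delta>" "\<bar>t2\<bar> < \<delta>"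
        unfolding t1_def t2_def abs_divide using \<open>d \<ge> 0\<close> s0
        by (auto elim!: le_less_trans[rotated] intro!: divide_right_mono)
      have "bounded_below (\<lambda>w. T (T w - t2 *\<^sub>R w) - t1 *\<^sub>R (T w - t2 *\<^sub>R w))"
        by (rule bounded_below_comp[OF below[OF t0(1) t(1)] below[OF t0(2) t(2)]])
      then obtain c where c: "c > 0"
        "\<And>w. c * norm w \<le> norm (T (T w - t2 *\<^sub>R w) - t1 *\<^sub>R (T w - t2 *\<^sub>R w))"
        unfolding bounded_below_def by blast
      have "bounded_linear (\<lambda>w. T (T w) - \<epsilon>\<^sup>2 *\<^sub>R w)"
        by (intro bounded_linear_sub bounded_linear_compose[OF lin(1) lin(1)] bounded_linear_scaleR_right)
      then obtain K where K: "K > 0" "\<And>w. norm (T (T w) - \<epsilon>\<^sup>2 *\<^sub>R w) \<le> norm w * K"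
        using bounded_linear.pos_bounded by blast
      have "(\<bar>s\<bar> * c / K) * norm x \<le> norm (C x - s *\<^sub>R x)" for x
      proof -
        obtain w where w: "x = T (T w) - \<epsilon>\<^sup>2 *\<^sub>R w" using surj by blast
        \<comment> \<open>With \<open>x = (T^2 - \<epsilon>^2) w\<close>, the relation
          \<open>C x = 2 T w\<close> turns \<open>(C - s) x\<close> into
          \<open>- s (T - t1) (T - t2) w\<close>, by the values of the sum and product of the
          roots.\<close>
        have "C x - s *\<^sub>R x = 2 *\<^sub>R T w - s *\<^sub>R T (T w) + (s * \<epsilon>\<^sup>2) *\<^sub>R w"
          by (simp add: w CT scaleR_diff_right)
        also have "\<dots> = (s * (t1 + t2)) *\<^sub>R T w - s *\<^sub>R T (T w) - (s * (t1 * t2)) *\<^sub>R w"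
          by (simp add: sum prod)
        also have "\<dots> = (- s) *\<^sub>R (T (T w - t2 *\<^sub>R w) - t1 *\<^sub>R (T w - t2 *\<^sub>R w))"
          by (simp add: lin algebra_simps)
        finally have "norm (C x - s *\<^sub>R x)
            = \<bar>s\<bar> * norm (T (T w - t2 *\<^sub>R w) - t1 *\<^sub>R (T w - t2 *\<^sub>R w))" by simp
        moreover have "(\<bar>s\<bar> * c / K) * norm x \<le> (\<bar>s\<bar> * c / K) * (norm w * K)"
          using K(2)[of w] c(1) K(1) by (intro mult_left_mono) (auto simp: w)
        moreover have "(\<bar>s\<bar> * c / K) * (norm w * K) = \<bar>s\<bar> * (c * norm w)" using K(1) by simp
        moreover have "\<bar>s\<bar> * (c * norm w) \<le> \<bar>s\<bar> * norm (T (T w - t2 *\<^sub>R w) - t1 *\<^sub>R (T w - t2 *\<^sub>R w))"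
          using c(2)[of w] by (intro mult_left_mono) auto
        ultimately show ?thesis by linarith
      qed
      moreover have "\<bar>s\<bar> * c / K > 0" using s0 c(1) K(1) by simp
      ultimately show "bounded_below (\<lambda>x. C x - s *\<^sub>R x)" unfolding bounded_below_def by blast
    qed (use \<open>\<delta> > 0\<close> in simp)
    from this[of "T (T u) - \<epsilon>\<^sup>2 *\<^sub>R u"] show ?thesis
      using \<open>\<delta> > 0\<close> by (simp add: CT field_simps)
  qed
  \<comment> \<open>The shift by 3 ensures \<open>\<delta> / (n + 3) < \<delta> / 2\<close>
    strictly, already for \<open>n = 0\<close>.\<close>
  have lim: "(\<lambda>n. \<delta> / real (n + 3)) \<longlonglongrightarrow> 0"
    by (rule LIMSEQ_ignore_initial_segment[OF lim_const_over_n])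
  have lim': "(\<lambda>n. 2 * norm (T (T x) - (\<delta> / real (n + 3))\<^sup>2 *\<^sub>R x)) \<longlonglongrightarrow> 2 * norm (T (T x) - 0\<^sup>2 *\<^sub>R x)"
    by (intro tendsto_intros lim)
  have "\<delta> * norm (T x) \<le> 2 * norm (T (T x) - (\<delta> / real (n + 3))\<^sup>2 *\<^sub>R x)" for n
    using \<open>\<delta> > 0\<close> by (intro step) (auto simp: field_simps intro: add_pos_nonneg)
  then have "\<delta> * norm (T x) \<le> 2 * norm (T (T x) - 0\<^sup>2 *\<^sub>R x)"
    by (intro LIMSEQ_le_const[OF lim']) blast
  then show ?thesis by simp
qed

text \<open>For self-adjoint \<open>L\<close> this says that the kernel is finite dimensional and the range closed;
  in this form it is visibly stable under compact perturbations.\<close>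

definition semi_fredholm :: "('a::real_normed_vector \<Rightarrow> 'b::real_normed_vector) \<Rightarrow> bool" where
  "semi_fredholm L \<longleftrightarrow> (\<forall>x::nat\<Rightarrow>'a. bounded (range x) \<longrightarrow> convergent (\<lambda>n. L (x n)) \<longrightarrow>
     (\<exists>r. strict_mono r \<and> convergent (x \<circ> r)))"

text \<open>The lower bound is asked only for differences of the sequence, so that it also serves
  operators that are bounded below merely on the complement of their kernel.\<close>

lemma bounded_below_convergent:
  assumes "bounded_linear L" and "c > 0" "\<And>n m. c * norm (x n - x m) \<le> norm (L (x n - x m))"
    and "convergent (\<lambda>n::nat. L (x n))"
  shows "convergent (x :: nat \<Rightarrow> 'a::banach)"
proof -
  have "Cauchy x"
  proof (rule metric_CauchyI)
    fix e :: real assume "e > 0"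
    then have "c * e > 0" using assms(2) by simp
    then obtain N where N: "\<And>m n. m \<ge> N \<Longrightarrow> n \<ge> N \<Longrightarrow> dist (L (x m)) (L (x n)) < c * e"
      using convergent_Cauchy[OF assms(4)] unfolding Cauchy_def by blast
    have "dist (x m) (x n) < e" if "m \<ge> N" "n \<ge> N" for m n
    proof -
      have "c * dist (x m) (x n) \<le> dist (L (x m)) (L (x n))"
        using assms(3)[of m n]
        by (simp add: dist_norm linear_diff[OF bounded_linear.linear[OF assms(1)]])
      also have "\<dots> < c * e" using N that by blast
      finally show ?thesis using assms(2) by simp
    qed
    then show "\<exists>N. \<forall>m\<ge>N. \<forall>n\<ge>N. dist (x m) (x n) < e" by blast
  qed
  then show ?thesis by (rule Cauchy_convergent)
qed

lemma semi_fredholm_if_bounded_below: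
  fixes L :: "'a::banach \<Rightarrow> 'b::real_normed_vector"
  assumes L: "bounded_linear L" and "bounded_below L"
  shows "semi_fredholm L"
  unfolding semi_fredholm_def
proof (intro allI impI)
  fix x :: "nat \<Rightarrow> 'a" assume conv: "convergent (\<lambda>n. L (x n))"
  obtain c where c: "c > 0" "\<And>x. c * norm x \<le> norm (L x)"
    using assms(2) unfolding bounded_below_def by blast
  have "convergent x" by (rule bounded_below_convergent[OF L c(1) c(2) conv])
  then show "\<exists>r. strict_mono r \<and> convergent (x \<circ> r)"
    by (intro exI[of _ id]) (simp add: strict_mono_id)
qed

section \<open>Kernel and lower bound of a semi-Fredholm operator\<close>

lemma complex_subspace_kernel:
  assumes "bounded_clinear T"
  shows "complex_vector.subspace {x. T x = 0}" "closed {x. T x = 0}"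
proof -
  show "complex_vector.subspace {x. T x = 0}"
    by (rule complex_vector.subspaceI) (auto simp: bounded_clinearD[OF assms])
  have "continuous_on UNIV T"
    using bounded_clinearD(1)[OF assms] by (simp add: linear_continuous_on)
  then show "closed {x. T x = 0}" by (intro closed_Collect_eq) auto
qed

lemma complex_subspace_range:
  assumes "bounded_clinear T"
  shows "complex_vector.subspace (range T)"
  using bounded_clinearD(2,3,6)[OF assms]
  by (intro complex_vector.subspaceI) (auto simp: image_iff intro: exI[of _ 0], metis+)

lemma kernel_decomposition:
  fixes T :: "'a::complex_hilbert \<Rightarrow> 'a"
  assumes "bounded_clinear T"
  obtains k u where "x = k + u" "T k = 0" "\<And>y. T y = 0 \<Longrightarrow> cinner u y = 0"
proof -
  obtain k where "k \<in> {x. T x = 0}" "\<And>y. y \<in> {x. T x = 0} \<Longrightarrow> cinner (x - k) y = 0"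
    using orthogonal_projection[OF complex_subspace_kernel[OF assms]] by blast
  then show thesis by (intro that[of k "x - k"]) auto
qed

text \<open>An orthonormal sequence in the kernel would be bounded with constant image 0, yet
  without a convergent subsequence.\<close>

lemma semi_fredholm_kernel:
  assumes T: "bounded_clinear T" and sf: "semi_fredholm T"
  shows "cdim {x. T x = 0} < \<infinity>"
proof (rule ccontr)
  assume "\<not> ?thesis"
  then have "cdim {x. T x = 0} = \<infinity>" by simp
  from infinite_cdim_orthonormal[OF complex_subspace_kernel(1)[OF T] this]
  obtain e where e: "orthonormal0 e" "\<And>n. e n \<in> {x. T x = 0}" "\<And>n. norm (e n) = 1" by blast
  have "bounded (range e)" by (rule boundedI[of _ 1]) (auto simp: e(3))
  moreover have "convergent (\<lambda>n. T (e n))" using e(2) by (simp add: convergent_const)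
  ultimately obtain r where "strict_mono r" "convergent (e \<circ> r)"
    using sf unfolding semi_fredholm_def by blast
  moreover have "cinner (e i) (e j) = 0" if "i \<noteq> j" for i j
    using e(1) that unfolding orthonormal0_def by blast
  ultimately show False using orthonormal_not_convergent e(3) by blast
qed

text \<open>Otherwise there are unit vectors orthogonal to the kernel with images tending to 0. A
  subsequential limit is a unit vector that lies in the kernel and is orthogonal to it.\<close>

lemma semi_fredholm_lower_bound:
  fixes T :: "'a::complex_hilbert \<Rightarrow> 'a"
  assumes T: "bounded_clinear T" and sf: "semi_fredholm T"
  obtains c where "c > 0" "\<And>x. (\<And>y. T y = 0 \<Longrightarrow> cinner x y = 0) \<Longrightarrow> c * norm x \<le> norm (T x)"
proof (rule ccontr)
  assume "\<not> thesis"
  then have no: "\<And>c. c > 0 \<Longrightarrow> \<exists>x. (\<forall>y. T y = 0 \<longrightarrow> cinner x y = 0) \<and> norm (T x) < c * norm x"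
    using that by (meson linorder_not_le)
  note lin = bounded_clinearD[OF T]
  have "\<exists>x. (\<forall>y. T y = 0 \<longrightarrow> cinner x y = 0) \<and> norm x = 1 \<and> norm (T x) < 1 / real (Suc n)" for n
  proof -
    obtain x where x: "\<forall>y. T y = 0 \<longrightarrow> cinner x y = 0" "norm (T x) < 1 / real (Suc n) * norm x"
      using no[of "1 / real (Suc n)"] by auto
    then have "x \<noteq> 0" using lin(6) by auto
    then show ?thesis using x
      by (intro exI[of _ "(1 / norm x) *\<^sub>R x"]) (auto simp: cinner_simps lin field_simps)
  qed
  then obtain x where x: "\<And>n y. T y = 0 \<Longrightarrow> cinner (x n) y = 0" "\<And>n. norm (x n) = 1"
    "\<And>n. norm (T (x n)) < 1 / real (Suc n)" by metis
  have Tx: "(\<lambda>n. T (x n)) \<longlonglongrightarrow> 0"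
    by (rule Lim_null_comparison[OF always_eventually LIMSEQ_Suc[OF lim_1_over_n]])
      (intro allI less_imp_le x(3))
  have "bounded (range x)" by (rule boundedI[of _ 1]) (auto simp: x(2))
  then obtain r z where r: "strict_mono r" "(x \<circ> r) \<longlonglongrightarrow> z"
    using sf Tx unfolding semi_fredholm_def convergent_def by meson
  have "(\<lambda>n. T ((x \<circ> r) n)) \<longlonglongrightarrow> T z" by (rule bounded_linear.tendsto[OF lin(1) r(2)])
  moreover have "(\<lambda>n. T ((x \<circ> r) n)) \<longlonglongrightarrow> 0" using LIMSEQ_subseq_LIMSEQ[OF Tx r(1)] by (simp add: o_def)
  ultimately have "T z = 0" by (rule LIMSEQ_unique)
  have "(\<lambda>n. cinner ((x \<circ> r) n) z) \<longlonglongrightarrow> cinner z z" by (intro tendsto_intros r(2))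
  then have "cinner z z = 0" using x(1)[OF \<open>T z = 0\<close>] by (simp add: LIMSEQ_const_iff)
  moreover have "norm z = 1"
    using tendsto_norm[OF r(2)] by (simp add: x(2) LIMSEQ_const_iff)
  ultimately show False by simp
qed

text \<open>Split the sequence along the kernel: the orthogonal parts converge by the lower bound,
  the kernel parts have a convergent subsequence by finite dimension.\<close>

lemma semi_fredholm_if_lower_bound:
  fixes T :: "'a::complex_hilbert \<Rightarrow> 'a"
  assumes T: "bounded_clinear T" and fin: "cdim {x. T x = 0} < \<infinity>" and c: "c > 0"
    and lower: "\<And>x. (\<And>y. T y = 0 \<Longrightarrow> cinner x y = 0) \<Longrightarrow> c * norm x \<le> norm (T x)"
  shows "semi_fredholm T"
  unfolding semi_fredholm_def
proof (intro allI impI)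
  fix x :: "nat \<Rightarrow> 'a"
  assume bdd: "bounded (range x)" and conv: "convergent (\<lambda>n. T (x n))"
  note lin = bounded_clinearD[OF T]
  have "\<exists>k u. x n = k + u \<and> T k = 0 \<and> (\<forall>y. T y = 0 \<longrightarrow> cinner u y = 0)" for n
    using kernel_decomposition[OF T, of "x n"] by metis
  then obtain k u where ku: "\<And>n. x n = k n + u n" "\<And>n. T (k n) = 0"
    "\<And>n y. T y = 0 \<Longrightarrow> cinner (u n) y = 0" by metis
  have "convergent u"
  proof (rule bounded_below_convergent[OF lin(1) c])
    show "c * norm (u n - u m) \<le> norm (T (u n - u m))" for n m
      by (rule lower) (simp add: cinner_simps ku(3))
    show "convergent (\<lambda>n. T (u n))" using conv by (simp add: ku(1,2) lin)
  qed
  then obtain l where l: "u \<longlonglongrightarrow> l" by (auto simp: convergent_def)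
  obtain M where M: "\<And>n. norm (x n) \<le> M" using bdd unfolding bounded_iff by blast
  have "(norm (k n))\<^sup>2 \<le> (norm (x n))\<^sup>2" for n
    using norm_add_orthogonal[of "k n" "u n"] ku by (simp add: cinner_zero_commute)
  then have "norm (k n) \<le> M" for n
    using M[of n] by (meson norm_ge_zero order_trans power2_le_imp_le)
  then have "bounded (range k)" by (intro boundedI[of _ M]) auto
  then obtain r :: "nat \<Rightarrow> nat" where r: "strict_mono r" "convergent (k \<circ> r)"
    using finite_cdim_convergent_subsequence[OF fin, of k] ku(2) by auto
  then obtain m where "(k \<circ> r) \<longlonglongrightarrow> m" by (auto simp: convergent_def)
  then have "(\<lambda>n. (k \<circ> r) n + (u \<circ> r) n) \<longlonglongrightarrow> m + l"
    by (intro tendsto_add LIMSEQ_subseq_LIMSEQ[OF l r(1)])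
  then have "convergent (x \<circ> r)" by (auto simp: convergent_def o_def ku(1))
  then show "\<exists>r. strict_mono r \<and> convergent (x \<circ> r)" using r(1) by blast
qed

text \<open>The bound at \<open>z\<close> gives injectivity and closed range; the bound at
  \<open>cnj z\<close> shows that the orthogonal complement of the range is trivial.\<close>

lemma sa_map_in_resolvent_set:
  fixes B :: "'a::complex_hilbert \<Rightarrow> 'a"
  assumes B: "sa_map B" and "bounded_below (\<lambda>x. B x - z *\<^sub>C x)"
    and "bounded_below (\<lambda>x. B x - cnj z *\<^sub>C x)"
  shows "z \<in> resolvent_set (Op UNIV B)"
proof -
  obtain c where c: "c > 0" "\<And>x. c * norm x \<le> norm (B x - z *\<^sub>C x)"
    using assms(2) unfolding bounded_below_def by blast
  obtain d where d: "d > 0" "\<And>x. d * norm x \<le> norm (B x - cnj z *\<^sub>C x)"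
    using assms(3) unfolding bounded_below_def by blast
  show ?thesis
  proof (rule self_adjoint_in_resolvent_set[OF self_adjoint_sa_map[OF B] c(1)])
    show "x = 0" if "app (Op UNIV B) x = cnj z *\<^sub>C x" for x
      using d(2)[of x] that d(1) by (simp add: mult_le_0_iff)
  qed (use c(2) in simp)
qed

lemma sa_map_shift:
  assumes "sa_map B"
  shows "sa_map (\<lambda>x. B x - of_real m *\<^sub>C x)"
proof -
  note lin = bounded_clinearD[OF sa_mapD(1)[OF assms]]
  have "bounded_linear (\<lambda>x. B x - of_real m *\<^sub>C x)"
    by (intro bounded_linear_sub lin(1) bounded_linear_scaleC)
  then show ?thesis
    unfolding sa_map_def bounded_clinear_def
    by (simp add: lin scaleC_diff_right scaleC_scaleC mult.commute cinner_simps sa_mapD(2)[OF assms])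
qed

text \<open>The right-hand side says that 0 is regular or in the discrete spectrum. From left to
  right, the lower bound on the complement of the kernel clears a punctured disc. Conversely, the
  spectral gap estimate is a lower bound for \<open>T\<close> on its range, which is dense in the
  complement of the kernel.\<close>

lemma semi_fredholm_zero_iff:
  fixes T :: "'a::complex_hilbert \<Rightarrow> 'a"
  assumes T: "sa_map T"
  shows "semi_fredholm T \<longleftrightarrow> 0 \<in> resolvent_set (Op UNIV T) \<or>
    ((\<forall>\<^sub>F z in at 0. z \<in> resolvent_set (Op UNIV T)) \<and> {x. T x = 0} \<noteq> {0} \<and> cdim {x. T x = 0} < \<infinity>)"
    (is "_ \<longleftrightarrow> ?reg \<or> ?iso")
proof
  note T' = sa_mapD(1)[OF T]
  note lin = bounded_clinearD[OF T']
  assume sf: "semi_fredholm T"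
  obtain c where c: "c > 0" "\<And>x. (\<And>y. T y = 0 \<Longrightarrow> cinner x y = 0) \<Longrightarrow> c * norm x \<le> norm (T x)"
    using semi_fredholm_lower_bound[OF T' sf] by blast
  show "?reg \<or> ?iso"
  proof (cases "{x. T x = 0} = {0}")
    case True
    then have "c * norm x \<le> norm (T x)" for x
      by (intro c(2)) (metis (mono_tags) cinner_zero_right mem_Collect_eq singletonD)
    then have "bounded_below T" unfolding bounded_below_def using c(1) by blast
    then have ?reg by (intro sa_map_in_resolvent_set[OF T]) simp_all
    then show ?thesis ..
  next
    case False
    have below: "bounded_below (\<lambda>x. T x - z *\<^sub>C x)" if z: "z \<noteq> 0" "cmod z < c" for z
    proof -
      \<comment> \<open>On the kernel \<open>T - z\<close> has size \<open>cmod z\<close>, on its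
        complement at least \<open>c - cmod z\<close>. Self-adjointness keeps the images of the two
        parts orthogonal, so the smaller constant serves the sum.\<close>
      define d where "d = min (cmod z) (c - cmod z)"
      have d: "d > 0" unfolding d_def using z by simp
      have "d * norm x \<le> norm (T x - z *\<^sub>C x)" for x
      proof -
        obtain k u where ku: "x = k + u" "T k = 0" "\<And>y. T y = 0 \<Longrightarrow> cinner u y = 0"
          using kernel_decomposition[OF T'] by blast
        have ort: "cinner k u = 0" using ku(3)[OF ku(2)] by (simp add: cinner_zero_commute)
        have "cinner k (T u) = 0" using sa_mapD(2)[OF T, of k u] ku(2) by simp
        then have "(norm ((- z) *\<^sub>C k + (T u - z *\<^sub>C u)))\<^sup>2
            = (cmod z * norm k)\<^sup>2 + (norm (T u - z *\<^sub>C u))\<^sup>2"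
          using ort by (subst norm_add_orthogonal) (auto simp: cinner_simps norm_scaleC)
        moreover have "(- z) *\<^sub>C k + (T u - z *\<^sub>C u) = T x - z *\<^sub>C x"
          by (simp add: ku lin scaleC_add_right)
        moreover have "(d * norm k)\<^sup>2 \<le> (cmod z * norm k)\<^sup>2"
          using d by (intro power_mono mult_right_mono) (auto simp: d_def)
        moreover have "(d * norm u)\<^sup>2 \<le> (norm (T u - z *\<^sub>C u))\<^sup>2"
        proof (rule power_mono)
          have "d * norm u \<le> (c - cmod z) * norm u" by (intro mult_right_mono) (auto simp: d_def)
          also have "\<dots> \<le> norm (T u) - norm (z *\<^sub>C u)"
            using c(2)[OF ku(3)] by (simp add: norm_scaleC left_diff_distrib)
          also have "\<dots> \<le> norm (T u - z *\<^sub>C u)" by (rule norm_triangle_ineq2)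
          finally show "d * norm u \<le> norm (T u - z *\<^sub>C u)" .
        qed (use d in auto)
        moreover have "(d * norm x)\<^sup>2 = (d * norm k)\<^sup>2 + (d * norm u)\<^sup>2"
          using norm_add_orthogonal[OF ort] by (simp add: ku(1) power_mult_distrib distrib_left)
        ultimately have "(d * norm x)\<^sup>2 \<le> (norm (T x - z *\<^sub>C x))\<^sup>2" by simp
        then show ?thesis by (rule power2_le_imp_le) simp
      qed
      then show ?thesis unfolding bounded_below_def using d by blast
    qed
    have "z \<in> resolvent_set (Op UNIV T)" if "z \<noteq> 0" "cmod z < c" for z
      using that by (intro sa_map_in_resolvent_set[OF T] below) auto
    then have "\<forall>\<^sub>F z in at 0. z \<in> resolvent_set (Op UNIV T)"
      unfolding eventually_at using c(1) by (auto simp: dist_norm)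
    then show ?thesis using False semi_fredholm_kernel[OF T' sf] by blast
  qed
next
  note T' = sa_mapD(1)[OF T]
  note lin = bounded_clinearD[OF T']
  assume "?reg \<or> ?iso"
  then show "semi_fredholm T"
  proof
    assume ?reg
    then have "bounded_below T" by (simp add: sa_map_in_resolvent_set_iff[OF T])
    then show ?thesis by (rule semi_fredholm_if_bounded_below[OF lin(1)])
  next
    assume iso: ?iso
    then obtain \<delta> where "\<delta> > 0" and \<delta>: "\<And>z. z \<noteq> 0 \<Longrightarrow> cmod z < \<delta> \<Longrightarrow> z \<in> resolvent_set (Op UNIV T)"
      unfolding eventually_at by (auto simp: dist_norm)
    have gap: "\<delta> * norm (T x) \<le> 2 * norm (T (T x))" for x
      using \<open>\<delta> > 0\<close> by (intro spectral_gap_bound[OF T] \<delta>) auto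
    show ?thesis
    proof (rule semi_fredholm_if_lower_bound[OF T'])
      show "cdim {x. T x = 0} < \<infinity>" using iso by blast
      show "\<delta> / 2 > 0" using \<open>\<delta> > 0\<close> by simp
      fix x assume x: "\<And>y. T y = 0 \<Longrightarrow> cinner x y = 0"
      note sub = complex_subspace_range[OF T']
      obtain m where m: "m \<in> closure (range T)" "\<And>y. y \<in> closure (range T) \<Longrightarrow> cinner (x - m) y = 0"
        using orthogonal_projection[OF complex_subspace_closure[OF sub] closed_closure] by blast
      \<comment> \<open>\<open>x - m\<close> is orthogonal to the range, hence in the kernel, to
        which both \<open>x\<close> and \<open>m\<close> are orthogonal; thus \<open>x = m\<close>
        lies in the closure of the range.\<close>
      have "cinner (T (x - m)) y = 0" for y
        unfolding sa_mapD(2)[OF T] using m(2) closure_subset by blast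
      then have "T (x - m) = 0" using cinner_eq_zero_iff by blast
      then have "cinner x (x - m) = 0" using x by blast
      moreover have "cinner m (x - m) = 0" using m by (simp add: cinner_zero_commute)
      ultimately have "cinner (x - m) (x - m) = 0" unfolding cinner_diff_left[of x m] by simp
      then have "x \<in> closure (range T)" using m(1) by simp
      then obtain w where w: "\<And>n. w n \<in> range T" "w \<longlonglongrightarrow> x" unfolding closure_sequential by blast
      show "\<delta> / 2 * norm x \<le> norm (T x)"
      proof (rule LIMSEQ_le)
        show "(\<lambda>n. \<delta> / 2 * norm (w n)) \<longlonglongrightarrow> \<delta> / 2 * norm x" by (intro tendsto_intros w(2))
        show "(\<lambda>n. norm (T (w n))) \<longlonglongrightarrow> norm (T x)"
          by (intro tendsto_norm bounded_linear.tendsto[OF lin(1) w(2)])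
        have "\<delta> / 2 * norm (w n) \<le> norm (T (w n))" for n
        proof -
          obtain y where "w n = T y" using w(1)[of n] by blast
          then show ?thesis using gap[of y] by simp
        qed
        then show "\<exists>N. \<forall>n\<ge>N. \<delta> / 2 * norm (w n) \<le> norm (T (w n))" by blast
      qed
    qed
  qed
qed

text \<open>A real \<open>z\<close> is absorbed into a self-adjoint shift; a nonreal
  \<open>z\<close> is a regular point, and then both sides are true.\<close>

lemma semi_fredholm_iff:
  fixes B :: "'a::complex_hilbert \<Rightarrow> 'a"
  assumes B: "sa_map B"
  shows "semi_fredholm (\<lambda>x. B x - z *\<^sub>C x) \<longleftrightarrow> z \<in> resolvent_set (Op UNIV B) \<or>
    ((\<forall>\<^sub>F w in at z. w \<in> resolvent_set (Op UNIV B)) \<and>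
      {x. B x = z *\<^sub>C x} \<noteq> {0} \<and> cdim {x. B x = z *\<^sub>C x} < \<infinity>)"
proof (cases "Im z = 0")
  case True
  define m where "m = Re z"
  have z: "z = of_real m" using True by (simp add: m_def complex_eq_iff)
  define T where "T = (\<lambda>x. B x - of_real m *\<^sub>C x)"
  have T: "sa_map T" unfolding T_def by (rule sa_map_shift[OF B])
  have "B x - (w + z) *\<^sub>C x = T x - w *\<^sub>C x" for x w
    by (simp add: T_def z scaleC_add_left)
  then have shift: "w \<in> resolvent_set (Op UNIV T) \<longleftrightarrow> w + z \<in> resolvent_set (Op UNIV B)" for w
    by (simp add: sa_map_in_resolvent_set_iff B T)
  have "(\<forall>\<^sub>F w in at z. w \<in> resolvent_set (Op UNIV B)) \<longleftrightarrow> (\<forall>\<^sub>F w in at 0. w \<in> resolvent_set (Op UNIV T))"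
    unfolding at_to_0[of z] eventually_filtermap shift ..
  moreover have "{x. B x = z *\<^sub>C x} = {x. T x = 0}" by (auto simp: T_def z)
  moreover have "(\<lambda>x. B x - z *\<^sub>C x) = T" by (simp add: T_def z)
  ultimately show ?thesis using semi_fredholm_zero_iff[OF T] shift[of 0] by simp
next
  case False
  note lin = bounded_clinearD[OF sa_mapD(1)[OF B]]
  have reg: "z \<in> resolvent_set (Op UNIV B)"
    by (rule self_adjoint_nonreal[OF self_adjoint_sa_map[OF B] False])
  then have below: "bounded_below (\<lambda>x. B x - z *\<^sub>C x)"
    unfolding sa_map_in_resolvent_set_iff[OF B] by blast
  have "bounded_linear (\<lambda>x. B x - z *\<^sub>C x)"
    by (intro bounded_linear_sub lin(1) bounded_linear_scaleC)
  then have "semi_fredholm (\<lambda>x. B x - z *\<^sub>C x)"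
    by (rule semi_fredholm_if_bounded_below[OF _ below])
  then show ?thesis using reg by blast
qed

section \<open>Essential spectrum in terms of the resolvent\<close>

lemma resolvent_kernel:
  fixes T :: "'a::complex_inner unbounded_op"
  assumes T: "linear_op T" and \<eta>: "\<eta> \<in> resolvent_set T" and "z \<noteq> \<eta>"
  shows "ker_shift T z = {x. resolvent T \<eta> x = (1 / (z - \<eta>)) *\<^sub>C x}"
proof -
  let ?R = "resolvent T \<eta>"
  note R = resolventD[OF \<eta>]
  note lin = bounded_clinearD[OF bounded_clinear_resolvent[OF T \<eta>]]
  have zn: "z - \<eta> \<noteq> 0" using assms(3) by simp
  have "?R x = (1 / (z - \<eta>)) *\<^sub>C x" if "x \<in> ker_shift T z" for x
  proof -
    have x: "x \<in> dom_of T" "app T x = z *\<^sub>C x" using that by (auto simp: ker_shift_def)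
    then have "app T x - \<eta> *\<^sub>C x = (z - \<eta>) *\<^sub>C x"
      by (simp add: complex_vector.scale_left_diff_distrib)
    then have "(z - \<eta>) *\<^sub>C ?R x = x" using R(3)[OF x(1)] by (simp add: lin)
    then have "?R x = (1 / (z - \<eta>) * (z - \<eta>)) *\<^sub>C ?R x" using zn by simp
    also have "\<dots> = (1 / (z - \<eta>)) *\<^sub>C x"
      unfolding scaleC_scaleC[symmetric] \<open>(z - \<eta>) *\<^sub>C ?R x = x\<close> ..
    finally show ?thesis .
  qed
  moreover have "x \<in> ker_shift T z" if x: "?R x = (1 / (z - \<eta>)) *\<^sub>C x" for x
  proof -
    have "(z - \<eta>) *\<^sub>C ?R x = x" unfolding x using zn by (simp add: scaleC_scaleC)
    then have "x \<in> dom_of T" "app T x = (z - \<eta>) *\<^sub>C (x + \<eta> *\<^sub>C ?R x)"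
      using linear_opD(4,6)[OF T R(1)] R(2) by metis+
    moreover have "(z - \<eta>) *\<^sub>C (x + \<eta> *\<^sub>C ?R x) = (z - \<eta>) *\<^sub>C x + \<eta> *\<^sub>C ((z - \<eta>) *\<^sub>C ?R x)"
      by (simp add: scaleC_add_right scaleC_scaleC mult.commute)
    ultimately show ?thesis
      using \<open>(z - \<eta>) *\<^sub>C ?R x = x\<close>
      by (simp add: ker_shift_def complex_vector.scale_left_diff_distrib)
  qed
  ultimately show ?thesis by blast
qed

text \<open>With \<open>R\<close> the resolvent at \<eta> and
  \<open>\<mu> = 1 / (z - \<eta>)\<close>, everything follows from the factorisation
  \<open>(T - z) R = - (1 / \<mu>) (R - \<mu>)\<close>, in which \<open>R\<close> is a bijection
  onto the domain.\<close>

lemma resolvent_set_transform: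
  fixes T :: "'a::complex_hilbert unbounded_op"
  assumes T: "self_adjoint T" and \<eta>: "of_real \<eta> \<in> resolvent_set T" and z: "z \<noteq> of_real \<eta>"
  shows "z \<in> resolvent_set T \<longleftrightarrow>
    1 / (z - of_real \<eta>) \<in> resolvent_set (Op UNIV (resolvent T (of_real \<eta>)))"
proof -
  let ?R = "resolvent T (of_real \<eta>)"
  note R = resolventD[OF \<eta>]
  note linop = self_adjointD(1)[OF T]
  define \<mu> where "\<mu> = 1 / (z - of_real \<eta>)"
  have \<mu>: "\<mu> \<noteq> 0" "- (1 / \<mu>) = of_real \<eta> - z" "- (1 / \<mu>) \<noteq> 0" unfolding \<mu>_def using z by auto
  define f where "f = (\<lambda>x. app T x - z *\<^sub>C x)"
  define g where "g = (\<lambda>x. ?R x - \<mu> *\<^sub>C x)"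
  have fR: "f (?R y) = (- (1 / \<mu>)) *\<^sub>C g y" for y
  proof -
    have "f (?R y) = (- (1 / \<mu>)) *\<^sub>C ?R y + (1 / \<mu> * \<mu>) *\<^sub>C y"
      unfolding f_def R(2) \<mu>(2) using \<mu>(1) by (simp add: complex_vector.scale_left_diff_distrib)
    then show ?thesis by (simp add: g_def scaleC_diff_right scaleC_scaleC)
  qed
  have bijR: "bij_betw ?R UNIV (dom_of T)"
    by (rule bij_betwI[of _ _ _ "\<lambda>x. app T x - of_real \<eta> *\<^sub>C x"]) (auto simp: R)
  have bijc: "bij (\<lambda>x::'a. (- (1 / \<mu>)) *\<^sub>C x)"
    by (rule bij_betwI[of _ _ _ "\<lambda>x. (- \<mu>) *\<^sub>C x"]) (use \<mu>(1) in \<open>auto simp: scaleC_scaleC\<close>)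
  have "bij_betw f (dom_of T) UNIV \<longleftrightarrow> bij_betw (f \<circ> ?R) UNIV UNIV"
    by (rule bij_betw_comp_iff[OF bijR])
  also have "f \<circ> ?R = (\<lambda>x. (- (1 / \<mu>)) *\<^sub>C x) \<circ> g" using fR by (auto simp: o_def)
  also have "bij_betw \<dots> UNIV UNIV \<longleftrightarrow> bij g"
    by (rule bij_betw_comp_iff2[OF bijc, symmetric]) simp
  finally have bij: "bij_betw f (dom_of T) UNIV \<longleftrightarrow> bij g" .
  have ng: "norm (g y) = cmod \<mu> * norm (f (?R y))" for y
    using \<mu>(1) by (simp add: fR norm_scaleC norm_divide)
  have "(\<exists>c>0. \<forall>x\<in>dom_of T. c * norm x \<le> norm (f x)) \<longleftrightarrow> bounded_below g"
  proof
    assume "\<exists>c>0. \<forall>x\<in>dom_of T. c * norm x \<le> norm (f x)"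
    then obtain c where c: "c > 0" "\<And>x. x \<in> dom_of T \<Longrightarrow> c * norm x \<le> norm (f x)" by blast
    \<comment> \<open>From \<open>\<mu> y = R y - g y\<close> and the bound of
      \<open>norm (R y)\<close> by \<open>norm (g y) / (cmod \<mu> * c)\<close>.\<close>
    define k where "k = cmod \<mu> / (1 / (cmod \<mu> * c) + 1)"
    have pos: "1 / (cmod \<mu> * c) + 1 > 0" using c(1) \<mu>(1) by (simp add: add_pos_pos)
    have "k * norm y \<le> norm (g y)" for y
    proof -
      have "cmod \<mu> * (c * norm (?R y)) \<le> norm (g y)"
        unfolding ng using c(2)[OF R(1)] by (intro mult_left_mono) auto
      then have "norm (?R y) \<le> 1 / (cmod \<mu> * c) * norm (g y)"
        using c(1) \<mu>(1) by (simp add: field_simps)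
      moreover have "norm (\<mu> *\<^sub>C y) \<le> norm (?R y) + norm (g y)"
        using norm_triangle_ineq4[of "?R y" "g y"] by (simp add: g_def)
      ultimately have "cmod \<mu> * norm y \<le> (1 / (cmod \<mu> * c) + 1) * norm (g y)"
        by (simp add: norm_scaleC distrib_right)
      then show ?thesis using pos unfolding k_def by (simp add: pos_divide_le_eq mult.commute)
    qed
    moreover have "k > 0" unfolding k_def using pos \<mu>(1) by simp
    ultimately show "bounded_below g" unfolding bounded_below_def by blast
  next
    assume "bounded_below g"
    then obtain d where d: "d > 0" "\<And>y. d * norm y \<le> norm (g y)" unfolding bounded_below_def by blast
    obtain K where K: "K > 0" "\<And>y. norm (?R y) \<le> norm y * K"
      using bounded_linear.pos_bounded[OF R(4)] by blast
    have "d / (K * cmod \<mu>) * norm x \<le> norm (f x)" if x: "x \<in> dom_of T" for x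
    proof -
      obtain y where y: "x = ?R y" using R(3)[OF x] by metis
      have "d * norm x \<le> d * (norm y * K)" unfolding y using K(2) d(1) by (intro mult_left_mono) auto
      also have "\<dots> = (d * norm y) * K" by simp
      also have "\<dots> \<le> norm (g y) * K" using d(2) K(1) by (intro mult_right_mono) auto
      finally show ?thesis using K(1) \<mu>(1) unfolding ng y by (simp add: field_simps)
    qed
    moreover have "d / (K * cmod \<mu>) > 0" using d(1) K(1) \<mu>(1) by simp
    ultimately show "\<exists>c>0. \<forall>x\<in>dom_of T. c * norm x \<le> norm (f x)" by blast
  qed
  then show ?thesis
    using bij unfolding in_resolvent_set_iff[OF linop] sa_map_in_resolvent_set_iff[OF sa_map_resolvent[OF T \<eta>]]
      f_def g_def \<mu>_def by blast
qed

text \<open>The map \<open>w -> 1 / (w - \<eta>)\<close> and its inverse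
  \<open>v -> \<eta> + 1 / v\<close> are continuous and injective near the points concerned, so they
  match punctured neighbourhoods. Staying away from \<open>w = \<eta>\<close> and
  \<open>v = 0\<close> keeps the pointwise equivalence available.\<close>

lemma resolvent_set_transform_eventually:
  fixes T :: "'a::complex_hilbert unbounded_op"
  assumes T: "self_adjoint T" and \<eta>: "of_real \<eta> \<in> resolvent_set T" and z: "z \<noteq> of_real \<eta>"
  shows "(\<forall>\<^sub>F w in at z. w \<in> resolvent_set T) \<longleftrightarrow>
    (\<forall>\<^sub>F w in at (1 / (z - of_real \<eta>)). w \<in> resolvent_set (Op UNIV (resolvent T (of_real \<eta>))))"
    (is "?L \<longleftrightarrow> ?R")
proof
  define h where "h = complex_of_real \<eta>"
  define \<mu> where "\<mu> = 1 / (z - h)"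
  have \<mu>: "\<mu> \<noteq> 0" "z = h + 1 / \<mu>" unfolding \<mu>_def using z by (auto simp: h_def)
  note tr = resolvent_set_transform[OF T \<eta>, folded h_def]
  {
    assume ?L
    have "filterlim (\<lambda>v. h + 1 / v) (at z) (at \<mu>)"
      unfolding filterlim_at
    proof
      show "\<forall>\<^sub>F v in at \<mu>. h + 1 / v \<in> UNIV \<and> h + 1 / v \<noteq> z"
        unfolding \<mu>(2) using \<mu>(1) by (auto simp: eventually_at_filter field_simps intro!: always_eventually)
      show "((\<lambda>v. h + 1 / v) \<longlongrightarrow> z) (at \<mu>)"
        unfolding \<mu>(2) using \<mu>(1) by (intro tendsto_intros)
    qed
    then have "\<forall>\<^sub>F v in at \<mu>. h + 1 / v \<in> resolvent_set T"
      by (rule eventually_compose_filterlim[OF \<open>?L\<close>])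
    moreover have "\<forall>\<^sub>F v in at \<mu>. v \<noteq> 0"
      using \<mu>(1) tendsto_imp_eventually_ne[OF tendsto_ident_at] by blast
    ultimately have "\<forall>\<^sub>F v in at \<mu>. v \<in> resolvent_set (Op UNIV (resolvent T h))"
    proof eventually_elim
      case (elim v)
      then show ?case using tr[of "h + 1 / v"] by simp
    qed
    then show ?R by (simp add: \<mu>_def h_def)
  next
    assume ?R
    then have R: "\<forall>\<^sub>F v in at \<mu>. v \<in> resolvent_set (Op UNIV (resolvent T h))"
      by (simp add: \<mu>_def h_def)
    have zh: "z - h \<noteq> 0" using z by (simp add: h_def)
    have ne: "\<forall>\<^sub>F w in at z. w \<noteq> h"
      using z tendsto_imp_eventually_ne[OF tendsto_ident_at] unfolding h_def by blast
    have "filterlim (\<lambda>w. 1 / (w - h)) (at \<mu>) (at z)"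
      unfolding filterlim_at
    proof
      have "\<forall>\<^sub>F w in at z. w \<noteq> z" by (simp add: eventually_at_filter)
      with ne show "\<forall>\<^sub>F w in at z. 1 / (w - h) \<in> UNIV \<and> 1 / (w - h) \<noteq> \<mu>"
        by eventually_elim (use zh in \<open>auto simp: \<mu>_def field_simps\<close>)
      show "((\<lambda>w. 1 / (w - h)) \<longlongrightarrow> \<mu>) (at z)"
        unfolding \<mu>_def using zh by (intro tendsto_intros)
    qed
    then have "\<forall>\<^sub>F w in at z. 1 / (w - h) \<in> resolvent_set (Op UNIV (resolvent T h))"
      by (rule eventually_compose_filterlim[OF R])
    with ne show ?L by eventually_elim (simp add: tr)
  }
qed

text \<open>Outside the essential spectrum a point is regular or discrete, which is the alternative
  characterising \<open>semi_fredholm\<close>. Regularity, isolation and eigenspaces are carried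
  separately through \<open>1 / (z - \<eta>)\<close>; \<eta> itself is regular.\<close>

lemma essential_spectrum_iff:
  fixes T :: "'a::complex_hilbert unbounded_op"
  assumes T: "self_adjoint T" and \<eta>: "of_real \<eta> \<in> resolvent_set T"
  shows "z \<in> essential_spectrum T \<longleftrightarrow> z \<noteq> of_real \<eta> \<and>
    \<not> semi_fredholm (\<lambda>x. resolvent T (of_real \<eta>) x - (1 / (z - of_real \<eta>)) *\<^sub>C x)"
proof (cases "z = of_real \<eta>")
  case True
  then show ?thesis using \<eta> by (simp add: essential_spectrum_def spectrum_def)
next
  case False
  have "z isolated_in spectrum T \<longleftrightarrow> (\<forall>\<^sub>F w in at z. w \<in> resolvent_set T)" if "z \<notin> resolvent_set T"
    using that by (simp add: isolated_in_islimpt_iff islimpt_iff_eventually spectrum_def)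
  then show ?thesis
    unfolding semi_fredholm_iff[OF sa_map_resolvent[OF T \<eta>]]
      resolvent_set_transform[OF T \<eta> False, symmetric]
      resolvent_set_transform_eventually[OF T \<eta> False, symmetric]
      resolvent_kernel[OF self_adjointD(1)[OF T] \<eta> False, symmetric]
    using False by (auto simp: essential_spectrum_def discrete_spectrum_def spectrum_def)
qed

text \<open>The inverse of an injective bounded self-adjoint map is self-adjoint: its domain
  \<open>range B\<close> is dense because anything orthogonal to it is in the kernel of
  \<open>B\<close>.\<close>

lemma self_adjoint_from_resolvent:
  fixes B :: "'a::complex_hilbert \<Rightarrow> 'a" and \<eta> :: real
  defines "A \<equiv> Op (range B) (\<lambda>x. of_real \<eta> *\<^sub>C x + inv B x)"
  assumes B: "sa_map B" and inj: "\<And>x. B x = 0 \<Longrightarrow> x = 0"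
  shows "self_adjoint A" "of_real \<eta> \<in> resolvent_set A" "resolvent A (of_real \<eta>) = B"
proof -
  note lin = bounded_clinearD[OF sa_mapD(1)[OF B]]
  note sa = sa_mapD(2)[OF B]
  have "inj B"
    by (rule injI) (metis inj lin(4) eq_iff_diff_eq_0)
  then have inv: "inv B (B x) = x" for x by simp
  have dom: "dom_of A = range B" and app: "app A (B x) = of_real \<eta> *\<^sub>C B x + x" for x
    by (simp_all add: A_def inv)
  note sub = complex_subspace_range[OF sa_mapD(1)[OF B]]
  have linop: "linear_op A"
    unfolding linear_op_def dom
  proof (intro conjI ballI allI sub)
    show "app A (x + y) = app A x + app A y" if xy: "x \<in> range B" "y \<in> range B" for x y
    proof -
      obtain u v where "x = B u" "y = B v" using xy by blast
      then show ?thesis using app[of "u + v"] by (simp add: lin app scaleC_add_right)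
    qed
    show "app A (c *\<^sub>C x) = c *\<^sub>C app A x" if x: "x \<in> range B" for c x
    proof -
      obtain u where "x = B u" using x by blast
      then show ?thesis using app[of "c *\<^sub>C u"]
        by (simp add: lin app scaleC_add_right scaleC_scaleC mult.commute)
    qed
  qed
  show sadj: "self_adjoint A"
    unfolding self_adjoint_iff
  proof (intro conjI linop allI)
    have "x = 0" if "\<forall>y\<in>range B. cinner x y = 0" for x
    proof (rule inj)
      have "cinner (B x) (B x) = 0" unfolding sa using that by blast
      then show "B x = 0" by simp
    qed
    then show "densely_defined A"
      unfolding densely_defined_def dom dense_iff_orthogonal[OF sub] by blast
    fix y z
    show "(\<forall>x\<in>dom_of A. cinner (app A x) y = cinner x z) \<longleftrightarrow> y \<in> dom_of A \<and> app A y = z"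
    proof
      assume a: "\<forall>x\<in>dom_of A. cinner (app A x) y = cinner x z"
      \<comment> \<open>Testing the adjoint relation on \<open>B f\<close> for every
        \<open>f\<close> identifies \<open>y\<close> as \<open>B (z - \<eta> y)\<close>, which puts
        it in the domain.\<close>
      have "cinner f (B (z - of_real \<eta> *\<^sub>C y) - y) = 0" for f
      proof -
        have "cinner (of_real \<eta> *\<^sub>C B f + f) y = cinner (B f) z"
          using a by (metis app dom rangeI)
        then show ?thesis
          by (simp add: cinner_simps lin sa algebra_simps)
      qed
      then have y: "y = B (z - of_real \<eta> *\<^sub>C y)"
        by (metis cinner_eq_zero_iff eq_iff_diff_eq_0)
      have "app A y = of_real \<eta> *\<^sub>C y + (z - of_real \<eta> *\<^sub>C y)"
        using app[of "z - of_real \<eta> *\<^sub>C y"] y by metis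
      then show "y \<in> dom_of A \<and> app A y = z" unfolding dom using y by (metis add_diff_cancel_left' diff_add_cancel add.commute rangeI)
    next
      assume "y \<in> dom_of A \<and> app A y = z"
      then obtain g where "y = B g" "z = of_real \<eta> *\<^sub>C B g + g" using app dom by auto
      then show "\<forall>x\<in>dom_of A. cinner (app A x) y = cinner x z"
        unfolding dom by (auto simp: app cinner_simps sa)
    qed
  qed
  have shift: "app A (B x) - of_real \<eta> *\<^sub>C B x = x" for x by (simp add: app)
  obtain K where K: "K > 0" "\<And>y. norm (B y) \<le> norm y * K"
    using bounded_linear.pos_bounded[OF lin(1)] by blast
  show reg: "of_real \<eta> \<in> resolvent_set A"
    unfolding in_resolvent_set_iff[OF linop]
  proof
    show "bij_betw (\<lambda>x. app A x - of_real \<eta> *\<^sub>C x) (dom_of A) UNIV"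
      by (rule bij_betwI[of _ _ _ B]) (auto simp: dom shift)
    have "1 / K * norm x \<le> norm (app A x - of_real \<eta> *\<^sub>C x)" if "x \<in> dom_of A" for x
      using that K by (auto simp: dom shift field_simps)
    then show "\<exists>c>0. \<forall>x\<in>dom_of A. c * norm x \<le> norm (app A x - of_real \<eta> *\<^sub>C x)"
      using K(1) by (intro exI[of _ "1 / K"]) simp
  qed
  show "resolvent A (of_real \<eta>) = B"
  proof
    fix x show "resolvent A (of_real \<eta>) x = B x"
      using resolventD(3)[OF reg, of "B x"] by (simp add: dom shift)
  qed
qed

section \<open>Real points of the resolvent set\<close>

lemma self_adjoint_real_in_resolvent_set:
  fixes T :: "'a::complex_hilbert unbounded_op"
  assumes T: "self_adjoint T" and c: "c > 0"
    and lower: "\<And>x. x \<in> dom_of T \<Longrightarrow> c * norm x \<le> norm (app T x - of_real r *\<^sub>C x)"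
  shows "of_real r \<in> resolvent_set T"
proof (rule self_adjoint_in_resolvent_set[OF T c lower])
  show "x = 0" if "x \<in> dom_of T" "app T x = cnj (of_real r) *\<^sub>C x" for x
    using lower[OF that(1)] that(2) c by (simp add: mult_le_0_iff)
qed

text \<open>A lower bound \<open>c\<close> at \<open>r\<close> leaves
  \<open>c - \<bar>s - r\<bar>\<close> at \<open>s\<close>. This is the room in which a point
  regular for a second operator can be sought.\<close>

lemma resolvent_set_real_open:
  fixes T :: "'a::complex_hilbert unbounded_op"
  assumes T: "self_adjoint T" and r: "of_real r \<in> resolvent_set T"
  obtains e where "e > 0" "\<And>s::real. \<bar>s - r\<bar> < e \<Longrightarrow> of_real s \<in> resolvent_set T"
proof -
  obtain c where c: "c > 0" "\<And>x. x \<in> dom_of T \<Longrightarrow> c * norm x \<le> norm (app T x - of_real r *\<^sub>C x)"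
    using r in_resolvent_set_iff[OF self_adjointD(1)[OF T]] by blast
  have "of_real s \<in> resolvent_set T" if "\<bar>s - r\<bar> < c" for s :: real
  proof (rule self_adjoint_real_in_resolvent_set[OF T])
    show "c - \<bar>s - r\<bar> > 0" using that by simp
    fix x assume x: "x \<in> dom_of T"
    have "app T x - of_real r *\<^sub>C x = (app T x - of_real s *\<^sub>C x) + (s - r) *\<^sub>R x"
      by (simp add: scaleC_of_real scaleR_left_diff_distrib)
    then have "norm (app T x - of_real r *\<^sub>C x) \<le> norm (app T x - of_real s *\<^sub>C x) + \<bar>s - r\<bar> * norm x"
      by (metis norm_triangle_ineq norm_scaleR)
    then show "(c - \<bar>s - r\<bar>) * norm x \<le> norm (app T x - of_real s *\<^sub>C x)"
      using c(2)[OF x] by (simp add: left_diff_distrib)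
  qed
  then show thesis using that c(1) by blast
qed

section \<open>Compact perturbations\<close>

text \<open>Formulated by extraction of subsequences, to compose directly with
  \<open>semi_fredholm\<close>.\<close>

definition sequentially_compact_map :: "('a::real_normed_vector \<Rightarrow> 'b::real_normed_vector) \<Rightarrow> bool" where
  "sequentially_compact_map K \<longleftrightarrow> (\<forall>x::nat\<Rightarrow>'a. bounded (range x) \<longrightarrow>
     (\<exists>r. strict_mono r \<and> convergent (\<lambda>n. K (x (r n)))))"

lemma compact_map_sequentially:
  assumes "compact_map K"
  shows "sequentially_compact_map K"
  unfolding sequentially_compact_map_def
proof (intro allI impI)
  fix x :: "nat \<Rightarrow> 'a" assume "bounded (range x)"
  then have "compact (closure (K ` range x))" using assms unfolding compact_map_def by blast
  then have "seq_compact (closure (K ` range x))" by (simp add: compact_eq_seq_compact_metric)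
  moreover have "\<forall>n. K (x n) \<in> closure (K ` range x)"
    by (auto intro: closure_subset[THEN subsetD])
  ultimately obtain l r where "strict_mono (r::nat\<Rightarrow>nat)" "((\<lambda>n. K (x n)) \<circ> r) \<longlonglongrightarrow> l"
    by (rule seq_compactE[of _ "\<lambda>n. K (x n)"])
  then show "\<exists>r. strict_mono r \<and> convergent (\<lambda>n. K (x (r n)))"
    by (auto simp: convergent_def o_def)
qed

text \<open>Along a subsequence on which \<open>K\<close> converges, convergence of
  \<open>L + K\<close> is convergence of \<open>L\<close>.\<close>

lemma semi_fredholm_compact_perturbation:
  assumes L: "semi_fredholm L" and K: "sequentially_compact_map K"
  shows "semi_fredholm (\<lambda>x. L x + K x)"
  unfolding semi_fredholm_def
proof (intro allI impI)
  fix x :: "nat \<Rightarrow> 'a" assume bdd: "bounded (range x)" and conv: "convergent (\<lambda>n. L (x n) + K (x n))"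
  obtain r where r: "strict_mono r" "convergent (\<lambda>n. K (x (r n)))"
    using K bdd unfolding sequentially_compact_map_def by blast
  have "convergent (\<lambda>n. L (x (r n)) + K (x (r n)))"
    using convergent_subseq_convergent[OF conv r(1)] by (simp add: o_def)
  from convergent_diff[OF this r(2)] have "convergent (\<lambda>n. L ((x \<circ> r) n))" by (simp add: o_def)
  moreover have "bounded (range (x \<circ> r))" by (rule bounded_subset[OF bdd]) auto
  ultimately obtain s where s: "strict_mono s" "convergent ((x \<circ> r) \<circ> s)"
    using L unfolding semi_fredholm_def by blast
  then show "\<exists>r. strict_mono r \<and> convergent (x \<circ> r)"
    using strict_mono_o[OF r(1) s(1)] by (auto simp: comp_assoc)
qed

lemma semi_fredholm_compact_perturbation_iff:
  assumes K: "sequentially_compact_map K"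
  shows "semi_fredholm (\<lambda>x. L x + K x) \<longleftrightarrow> semi_fredholm L"
proof
  have "sequentially_compact_map (\<lambda>x. - K x)"
    unfolding sequentially_compact_map_def
  proof (intro allI impI)
    fix x :: "nat \<Rightarrow> 'a" assume "bounded (range x)"
    then obtain r where "strict_mono r" "convergent (\<lambda>n. K (x (r n)))"
      using K unfolding sequentially_compact_map_def by blast
    then show "\<exists>r. strict_mono r \<and> convergent (\<lambda>n. - K (x (r n)))"
      unfolding convergent_minus_iff[symmetric] by blast
  qed
  then show "semi_fredholm L" if "semi_fredholm (\<lambda>x. L x + K x)"
    using semi_fredholm_compact_perturbation[OF that, of "\<lambda>x. - K x"] by simp
qed (rule semi_fredholm_compact_perturbation[OF _ K])

lemma bounded_range_linear_image:
  assumes "bounded_linear L" "bounded (range x)"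
  shows "bounded (range (\<lambda>n. L (x n)))"
  using bounded_linear_image[OF assms(2,1)] by (simp add: image_image)

lemma convergent_linear_image:
  assumes "bounded_linear L" "convergent x"
  shows "convergent (\<lambda>n. L (x n))"
  using bounded_linear.tendsto[OF assms(1)] assms(2) unfolding convergent_def by blast

text \<open>\<open>\<iota>\<close> is an isometry with adjoint \<open>j\<close>. On the complement of its range \<open>\<iota> R j\<close> vanishes,
  which only affects the point \<open>0\<close>.\<close>

lemma semi_fredholm_isometry_iff:
  fixes \<iota> :: "'g::complex_hilbert \<Rightarrow> 'h::complex_hilbert"
  assumes \<iota>: "bounded_clinear \<iota>" and j: "bounded_clinear j" and R: "bounded_clinear R"
    and j\<iota>: "\<And>y. j (\<iota> y) = y" and \<mu>: "\<mu> \<noteq> 0"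
  shows "semi_fredholm (\<lambda>x. \<iota> (R (j x)) - \<mu> *\<^sub>C x) \<longleftrightarrow> semi_fredholm (\<lambda>y. R y - \<mu> *\<^sub>C y)"
proof
  note li = bounded_clinearD[OF \<iota>] and lj = bounded_clinearD[OF j] and lR = bounded_clinearD[OF R]
  {
    assume L: "semi_fredholm (\<lambda>x. \<iota> (R (j x)) - \<mu> *\<^sub>C x)"
    show "semi_fredholm (\<lambda>y. R y - \<mu> *\<^sub>C y)"
      unfolding semi_fredholm_def
    proof (intro allI impI)
      fix y :: "nat \<Rightarrow> 'g"
      assume bdd: "bounded (range y)" and conv: "convergent (\<lambda>n. R (y n) - \<mu> *\<^sub>C y n)"
      have "convergent (\<lambda>n. \<iota> (R (j (\<iota> (y n)))) - \<mu> *\<^sub>C \<iota> (y n))"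
        using convergent_linear_image[OF li(1) conv] by (simp add: j\<iota> li)
      then obtain r where r: "strict_mono r" "convergent ((\<lambda>n. \<iota> (y n)) \<circ> r)"
        using L bounded_range_linear_image[OF li(1) bdd] unfolding semi_fredholm_def by blast
      have "convergent (y \<circ> r)"
        using convergent_linear_image[OF lj(1) r(2)] by (simp add: j\<iota> o_def)
      then show "\<exists>r. strict_mono r \<and> convergent (y \<circ> r)" using r(1) by blast
    qed
  next
    assume L: "semi_fredholm (\<lambda>y. R y - \<mu> *\<^sub>C y)"
    show "semi_fredholm (\<lambda>x. \<iota> (R (j x)) - \<mu> *\<^sub>C x)"
      unfolding semi_fredholm_def
    proof (intro allI impI)
      fix x :: "nat \<Rightarrow> 'h"
      assume bdd: "bounded (range x)" and conv: "convergent (\<lambda>n. \<iota> (R (j (x n))) - \<mu> *\<^sub>C x n)"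
      have "convergent (\<lambda>n. R (j (x n)) - \<mu> *\<^sub>C j (x n))"
        using convergent_linear_image[OF lj(1) conv] by (simp add: j\<iota> lj)
      then obtain r where r: "strict_mono r" "convergent ((\<lambda>n. j (x n)) \<circ> r)"
        using L bounded_range_linear_image[OF lj(1) bdd] unfolding semi_fredholm_def by blast
      have "convergent (\<lambda>n. \<iota> (R (j (x (r n)))))"
        using convergent_linear_image[OF li(1) convergent_linear_image[OF lR(1) r(2)]] by (simp add: o_def)
      note conv_image = this
      have "convergent (\<lambda>n. \<iota> (R (j (x (r n)))) - \<mu> *\<^sub>C x (r n))"
        using convergent_subseq_convergent[OF conv r(1)] by (simp add: o_def)
      from convergent_diff[OF conv_image this] have "convergent (\<lambda>n. \<mu> *\<^sub>C x (r n))" by simp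
      from convergent_linear_image[OF bounded_linear_scaleC this, of "1 / \<mu>"]
      have "convergent (x \<circ> r)" using \<mu> by (simp add: scaleC_scaleC o_def)
      then show "\<exists>r. strict_mono r \<and> convergent (x \<circ> r)" using r(1) by blast
    qed
  }
qed

text \<open>Compact embedding of the domain with the graph norm. It no longer refers to the point at
  which the resolvent is known to be compact.\<close>

lemma compact_resolvent_graph:
  fixes T :: "'a::complex_inner unbounded_op"
  assumes "compact_resolvent T" "\<And>n. x n \<in> dom_of T" "bounded (range x)" "bounded (range (\<lambda>n. app T (x n)))"
  obtains r :: "nat \<Rightarrow> nat" where "strict_mono r" "convergent (x \<circ> r)"
proof -
  obtain z where z: "z \<in> resolvent_set T" "compact_map (resolvent T z)"
    using assms(1) unfolding compact_resolvent_def by blast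
  have "bounded (range (\<lambda>n. app T (x n) - z *\<^sub>C x n))"
    by (intro bounded_minus_comp assms(4) bounded_range_linear_image[OF bounded_linear_scaleC assms(3)])
  then obtain r :: "nat \<Rightarrow> nat" where r: "strict_mono r"
    "convergent (\<lambda>n. resolvent T z (app T (x (r n)) - z *\<^sub>C x (r n)))"
    using compact_map_sequentially[OF z(2)] unfolding sequentially_compact_map_def by blast
  then have "convergent (x \<circ> r)" by (simp add: resolventD(3)[OF z(1) assms(2)] o_def)
  then show thesis using that r(1) by blast
qed

text \<open>Every resolvent sends bounded sequences to sequences bounded in the graph norm; this
  takes the place of the resolvent identity.\<close>

lemma compact_resolvent_sequentially:
  fixes T :: "'a::complex_inner unbounded_op"
  assumes "compact_resolvent T" and z: "z \<in> resolvent_set T"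
  shows "sequentially_compact_map (resolvent T z)"
  unfolding sequentially_compact_map_def
proof (intro allI impI)
  fix x :: "nat \<Rightarrow> 'a" assume bdd: "bounded (range x)"
  note R = resolventD[OF z]
  have bR: "bounded (range (\<lambda>n. resolvent T z (x n)))" by (rule bounded_range_linear_image[OF R(4) bdd])
  have "bounded (range (\<lambda>n. app T (resolvent T z (x n))))"
    unfolding R(2)
    by (intro bounded_plus_comp bdd bounded_range_linear_image[OF bounded_linear_scaleC bR])
  then obtain r :: "nat \<Rightarrow> nat" where "strict_mono r" "convergent ((\<lambda>n. resolvent T z (x n)) \<circ> r)"
    using compact_resolvent_graph[OF assms(1) R(1) bR] by blast
  then show "\<exists>r. strict_mono r \<and> convergent (\<lambda>n. resolvent T z (x (r n)))" by (auto simp: o_def)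
qed

text \<open>Failure of every lower bound at \<open>l\<close> gives approximate eigenvectors. They
  are bounded in the graph norm, and a subsequential limit is a genuine eigenvector by the adjoint
  relation.\<close>

lemma compact_resolvent_eigenvalue:
  fixes T :: "'a::complex_hilbert unbounded_op"
  assumes T: "self_adjoint T" and comp: "compact_resolvent T" and "of_real l \<notin> resolvent_set T"
  obtains x where "x \<in> dom_of T" "norm x = 1" "app T x = l *\<^sub>R x"
proof -
  note lin = linear_opD[OF self_adjointD(1)[OF T]]
  have "\<exists>x\<in>dom_of T. norm x = 1 \<and> norm (app T x - l *\<^sub>R x) < 1 / real (Suc n)" for n
  proof -
    have "\<not> (\<forall>x\<in>dom_of T. 1 / real (Suc n) * norm x \<le> norm (app T x - of_real l *\<^sub>C x))"
      using self_adjoint_real_in_resolvent_set[OF T, of "1 / real (Suc n)" l] assms(3) by auto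
    then obtain x where x: "x \<in> dom_of T" "norm (app T x - l *\<^sub>R x) < 1 / real (Suc n) * norm x"
      unfolding scaleC_of_real by (meson linorder_not_le)
    then have x0: "x \<noteq> 0" using lin(9) by auto
    define y where "y = of_real (1 / norm x) *\<^sub>C x"
    have y: "y = (1 / norm x) *\<^sub>R x" unfolding y_def by (rule scaleC_of_real)
    have "app T y = (1 / norm x) *\<^sub>R app T x" unfolding y_def lin(6)[OF x(1)] by (rule scaleC_of_real)
    then have "app T y - l *\<^sub>R y = (1 / norm x) *\<^sub>R (app T x - l *\<^sub>R x)"
      by (simp add: y scaleR_diff_right mult.commute)
    then have "norm (app T y - l *\<^sub>R y) = norm (app T x - l *\<^sub>R x) / norm x" by simp
    then have "norm (app T y - l *\<^sub>R y) < 1 / real (Suc n)"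
      using x(2) x0 by (simp add: pos_divide_less_eq)
    moreover have "y \<in> dom_of T" "norm y = 1" using lin(4)[OF x(1)] x0 by (auto simp: y_def norm_scaleC norm_divide)
    ultimately show ?thesis by blast
  qed
  then obtain x where x: "\<And>n. x n \<in> dom_of T" "\<And>n. norm (x n) = 1"
    "\<And>n. norm (app T (x n) - l *\<^sub>R x n) < 1 / real (Suc n)" by metis
  have diff: "(\<lambda>n. app T (x n) - l *\<^sub>R x n) \<longlonglongrightarrow> 0"
    by (rule Lim_null_comparison[OF always_eventually LIMSEQ_Suc[OF lim_1_over_n]])
      (intro allI less_imp_le x(3))
  have bx: "bounded (range x)" by (rule boundedI[of _ 1]) (auto simp: x(2))
  have "bounded (range (\<lambda>n. (app T (x n) - l *\<^sub>R x n) + l *\<^sub>R x n))"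
    by (intro bounded_plus_comp convergent_imp_bounded[OF diff]
        bounded_range_linear_image[OF bounded_linear_scaleR_right bx])
  then have "bounded (range (\<lambda>n. app T (x n)))" by simp
  then obtain r' :: "nat \<Rightarrow> nat" where r': "strict_mono r'" "convergent (x \<circ> r')"
    by (rule compact_resolvent_graph[OF comp x(1) bx])
  then obtain r :: "nat \<Rightarrow> nat" and y where r: "strict_mono r" "(\<lambda>n. x (r n)) \<longlonglongrightarrow> y"
    by (auto simp: convergent_def o_def)
  have "(\<lambda>n. (app T (x (r n)) - l *\<^sub>R x (r n)) + l *\<^sub>R x (r n)) \<longlonglongrightarrow> 0 + l *\<^sub>R y"
    using LIMSEQ_subseq_LIMSEQ[OF diff r(1)] by (intro tendsto_intros r(2)) (simp add: o_def)
  then have Tx: "(\<lambda>n. app T (x (r n))) \<longlonglongrightarrow> l *\<^sub>R y" by simp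
  have w: "cinner (app T w) y = cinner w (l *\<^sub>R y)" if w: "w \<in> dom_of T" for w
  proof (rule LIMSEQ_unique)
    show "(\<lambda>n. cinner (app T w) (x (r n))) \<longlonglongrightarrow> cinner (app T w) y" by (intro tendsto_intros r(2))
    show "(\<lambda>n. cinner (app T w) (x (r n))) \<longlonglongrightarrow> cinner w (l *\<^sub>R y)"
      unfolding self_adjointD(2)[OF T w x(1)] by (intro tendsto_intros Tx)
  qed
  have "norm y = 1" using tendsto_norm[OF r(2)] by (simp add: x(2) LIMSEQ_const_iff)
  then show thesis using that self_adjointD(3)[OF T w] self_adjointD(4)[OF T w] by blast
qed

text \<open>Otherwise \<open>(a - e, a + e)\<close> would consist of eigenvalues, and a convergent sequence of them
  would have orthonormal eigenvectors with a convergent subsequence.\<close>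

lemma compact_resolvent_real_point:
  fixes T :: "'a::complex_hilbert unbounded_op"
  assumes T: "self_adjoint T" and comp: "compact_resolvent T" and "e > 0"
  obtains s :: real where "\<bar>s - a\<bar> < e" "of_real s \<in> resolvent_set T"
proof (rule ccontr)
  assume "\<not> thesis"
  note point = that
  have no: "of_real s \<notin> resolvent_set T" if "\<bar>s - a\<bar> < e" for s :: real
    using point[OF that] \<open>\<not> thesis\<close> by blast
  \<comment> \<open>Distinct points accumulating at \<open>a\<close>; the shift by 2 keeps
    \<open>l 0\<close> strictly below \<open>a + e\<close>.\<close>
  define l where "l = (\<lambda>n. a + e / real (n + 2))"
  have l: "\<bar>l n - a\<bar> < e" for n
    using \<open>e > 0\<close> by (simp add: l_def field_simps add_pos_nonneg)
  have linj: "l m \<noteq> l n" if "m \<noteq> n" for m n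
    using that \<open>e > 0\<close> by (simp add: l_def frac_eq_eq)
  have "\<exists>x. x \<in> dom_of T \<and> norm x = 1 \<and> app T x = l n *\<^sub>R x" for n
    using compact_resolvent_eigenvalue[OF T comp no[OF l]] by metis
  then obtain x where x: "\<And>n. x n \<in> dom_of T" "\<And>n. norm (x n) = 1" "\<And>n. app T (x n) = l n *\<^sub>R x n"
    by metis
  have orth: "cinner (x m) (x n) = 0" if "m \<noteq> n" for m n
  proof -
    have "of_real (l m) * cinner (x m) (x n) = of_real (l n) * cinner (x m) (x n)"
      using self_adjointD(2)[OF T x(1) x(1), of m n] by (simp add: x(3) cinner_simps)
    then show ?thesis using linj[OF that] by simp
  qed
  have bx: "bounded (range x)" by (rule boundedI[of _ 1]) (auto simp: x(2))
  have bT: "bounded (range (\<lambda>n. app T (x n)))"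
  proof (rule boundedI[of _ "\<bar>a\<bar> + e"])
    fix y assume "y \<in> range (\<lambda>n. app T (x n))"
    then obtain n where "y = app T (x n)" by blast
    then show "norm y \<le> \<bar>a\<bar> + e" using l[of n] by (simp add: x(2,3))
  qed
  obtain r :: "nat \<Rightarrow> nat" where "strict_mono r" "convergent (x \<circ> r)"
    by (rule compact_resolvent_graph[OF comp x(1) bx bT])
  then show False using orthonormal_not_convergent[of x r, OF orth x(2)] by blast
qed

section \<open>The extension\<close>

text \<open>The kernel of the adjoint minus \<open>z\<close>, written without the adjoint;
  equivalently, the orthogonal complement of the range of \<open>S - cnj z\<close>.\<close>

definition deficiency_space :: "'a::complex_inner unbounded_op \<Rightarrow> complex \<Rightarrow> 'a set" where
  "deficiency_space S z = {f. \<forall>x\<in>dom_of S. cinner (app S x) f = cinner x (z *\<^sub>C f)}"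

lemma complex_subspace_deficiency: "complex_vector.subspace (deficiency_space S z)"
  unfolding deficiency_space_def
  by (rule complex_vector.subspaceI) (auto simp: cinner_simps algebra_simps)

lemma ker_shift_adjoint:
  fixes S :: "'a::complex_hilbert unbounded_op"
  assumes S: "linear_op S" "densely_defined S"
  shows "ker_shift (adjoint_op S) z = deficiency_space S z"
proof -
  let ?P = "\<lambda>y w. \<forall>x\<in>dom_of S. cinner (app S x) y = cinner x w"
  have the: "(THE w. ?P y w) = w" if "?P y w" for y w
    using that adjoint_unique[OF S] by (intro the_equality) blast+
  show ?thesis
  proof (rule set_eqI)
    fix y
    have "y \<in> ker_shift (adjoint_op S) z \<longleftrightarrow> (\<exists>w. ?P y w) \<and> (THE w. ?P y w) = z *\<^sub>C y"
      unfolding ker_shift_def adjoint_op_def by simp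
    also have "\<dots> \<longleftrightarrow> ?P y (z *\<^sub>C y)"
    proof
      assume *: "(\<exists>w. ?P y w) \<and> (THE w. ?P y w) = z *\<^sub>C y"
      then obtain w where w: "?P y w" by blast
      have "w = z *\<^sub>C y" using the[OF w] * by simp
      then show "?P y (z *\<^sub>C y)" using w by simp
    next
      assume w: "?P y (z *\<^sub>C y)"
      show "(\<exists>w. ?P y w) \<and> (THE w. ?P y w) = z *\<^sub>C y"
        by (rule conjI[OF exI[of "?P y", OF w] the[OF w]])
    qed
    finally show "y \<in> ker_shift (adjoint_op S) z \<longleftrightarrow> y \<in> deficiency_space S z"
      by (simp add: deficiency_space_def)
  qed
qed

lemma linear_image_in_span:
  assumes W: "bounded_clinear W" and "x \<in> complex_vector.span B"
  shows "W x \<in> complex_vector.span (W ` B)"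
proof -
  note lin = bounded_clinearD[OF W]
  have "complex_vector.span B \<subseteq> {x. W x \<in> complex_vector.span (W ` B)}"
    by (rule complex_vector.span_minimal)
      (auto simp: complex_vector.subspace_def lin complex_vector.span_zero complex_vector.span_add
        complex_vector.span_scale complex_vector.span_base)
  then show ?thesis using assms(2) by blast
qed

text \<open>With \<open>R z = (A\<^sub>0 - z)\<^sup>-\<^sup>1\<close>, the map \<open>1 + (w - z) R w\<close> takes the deficiency space at \<open>z\<close> into
  the one at \<open>w\<close>, and \<open>1 + (z - w) R z\<close> is its left inverse.\<close>

lemma deficiency_space_infinite:
  fixes S A0 :: "'a::complex_hilbert unbounded_op"
  assumes A0: "self_adjoint A0" and ext: "extends A0 S"
    and z: "z \<in> resolvent_set A0" and w: "w \<in> resolvent_set A0"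
    and inf: "cdim (deficiency_space S z) = \<infinity>"
  shows "cdim (deficiency_space S w) = \<infinity>"
proof (rule ccontr)
  assume "cdim (deficiency_space S w) \<noteq> \<infinity>"
  then obtain B where B: "finite B" "deficiency_space S w \<subseteq> complex_vector.span B"
    using cdim_finite_iff[of "deficiency_space S w"] by auto
  note Rz = resolventD[OF z] and Rw = resolventD[OF w]
  \<comment> \<open>\<open>V\<close> is \<open>(A0 - z) (A0 - w)^-1\<close> and \<open>W\<close> is
    \<open>(A0 - w) (A0 - z)^-1\<close>. A finite spanning set at \<open>w\<close> is therefore
    pulled back by \<open>W\<close> to one at \<open>z\<close>.\<close>
  define V where "V = (\<lambda>f. f + (w - z) *\<^sub>C resolvent A0 w f)"
  define W where "W = (\<lambda>f. f + (z - w) *\<^sub>C resolvent A0 z f)"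
  have Vdef: "V f \<in> deficiency_space S w" if f: "f \<in> deficiency_space S z" for f
    unfolding deficiency_space_def
  proof (intro CollectI ballI)
    fix x assume x: "x \<in> dom_of S"
    then have xA: "x \<in> dom_of A0" "app A0 x = app S x" using ext by (auto simp: extends_def)
    have "cinner (app S x) f = cinner x (z *\<^sub>C f)" using f x by (simp add: deficiency_space_def)
    moreover have "cinner (app S x) (resolvent A0 w f) = cinner x (f + w *\<^sub>C resolvent A0 w f)"
      using self_adjointD(2)[OF A0 xA(1) Rw(1), of f] by (simp add: xA(2) Rw(2))
    ultimately show "cinner (app S x) (V f) = cinner x (w *\<^sub>C V f)"
      by (simp add: V_def cinner_simps algebra_simps)
  qed
  have WV: "W (V f) = f" for f
  proof -
    define y where "y = resolvent A0 w f"
    have f: "f = app A0 y - w *\<^sub>C y" by (simp add: y_def Rw(2))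
    have Vf: "V f = app A0 y - z *\<^sub>C y"
      unfolding V_def y_def[symmetric] by (subst f) (simp add: complex_vector.scale_left_diff_distrib)
    have "resolvent A0 z (V f) = y" unfolding Vf by (rule Rz(3)) (simp add: y_def Rw(1))
    then have "W (V f) = V f + (z - w) *\<^sub>C y" by (simp add: W_def)
    also have "\<dots> = app A0 y - w *\<^sub>C y"
      unfolding Vf by (simp add: complex_vector.scale_left_diff_distrib)
    finally show ?thesis by (simp add: f[symmetric])
  qed
  note linz = bounded_clinearD[OF bounded_clinear_resolvent[OF self_adjointD(1)[OF A0] z]]
  have W: "bounded_clinear W"
    unfolding bounded_clinear_def W_def
    by (auto intro!: bounded_linear_add bounded_linear_ident
        bounded_linear_compose[OF bounded_linear_scaleC linz(1)]
        simp: linz(2) scaleC_add_right scaleC_scaleC mult.commute)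
  have "deficiency_space S z \<subseteq> complex_vector.span (W ` B)"
  proof
    fix f assume "f \<in> deficiency_space S z"
    then have "V f \<in> complex_vector.span B" using Vdef B(2) by blast
    from linear_image_in_span[OF W this] show "f \<in> complex_vector.span (W ` B)" by (simp add: WV)
  qed
  then have "cdim (deficiency_space S z) < \<infinity>" using B(1) cdim_finite_iff by blast
  then show False using inf by simp
qed

theorem theorem4p3:
  fixes S :: "'h::complex_hilbert unbounded_op"
    and \<Xi> :: "'g::complex_hilbert unbounded_op"
  assumes "separable_space (euclidean :: 'h topology)" and "cdim (UNIV :: 'h set) = \<infinity>"
    and "linear_op S" and "densely_defined S" and "closed_op S" and "symmetric_op S"
    and "deficiency_plus S = \<infinity>" and "deficiency_minus S = \<infinity>"
    and "\<exists>A0. self_adjoint A0 \<and> extends A0 S \<and> compact_resolvent A0"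
    and "separable_space (euclidean :: 'g topology)" and "cdim (UNIV :: 'g set) = \<infinity>"
    and "self_adjoint \<Xi>" and "\<real> \<inter> resolvent_set \<Xi> \<noteq> {}"
  shows "\<exists>A. self_adjoint A \<and> extends A S \<and> essential_spectrum A = essential_spectrum \<Xi>"
proof -
  obtain A0 where A0: "self_adjoint A0" and ext: "extends A0 S" and comp: "compact_resolvent A0"
    using assms(9) by blast
  note \<Xi> = assms(12)
  obtain a :: real where "of_real a \<in> resolvent_set \<Xi>" using assms(13) by (auto elim: Reals_cases)
  then obtain e where e: "e > 0" "\<And>s::real. \<bar>s - a\<bar> < e \<Longrightarrow> of_real s \<in> resolvent_set \<Xi>"
    using resolvent_set_real_open[OF \<Xi>] by blast
  obtain \<eta> :: real where "\<bar>\<eta> - a\<bar> < e" and \<eta>0: "of_real \<eta> \<in> resolvent_set A0"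
    using compact_resolvent_real_point[OF A0 comp e(1)] by blast
  then have \<eta>: "of_real \<eta> \<in> resolvent_set \<Xi>" using e(2) by blast
  define h where "h = complex_of_real \<eta>"
  define R0 where "R0 = resolvent A0 h"
  define R where "R = resolvent \<Xi> h"
  have sa0: "sa_map R0" and sa: "sa_map R"
    unfolding R0_def R_def h_def by (rule sa_map_resolvent[OF A0 \<eta>0], rule sa_map_resolvent[OF \<Xi> \<eta>])
  note res0 = resolventD[OF \<eta>0, folded h_def, folded R0_def]

  have "cdim (deficiency_space S \<i>) = \<infinity>"
    using assms(7) unfolding deficiency_plus_def ker_shift_adjoint[OF assms(3,4)] .
  moreover have "\<i> \<in> resolvent_set A0" by (rule self_adjoint_nonreal[OF A0]) simp
  ultimately have "cdim (deficiency_space S h) = \<infinity>"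
    using deficiency_space_infinite[OF A0 ext _ \<eta>0] unfolding h_def by blast
  from infinite_cdim_orthonormal[OF complex_subspace_deficiency this]
  obtain b where b: "orthonormal0 b" "\<And>n. b n \<in> deficiency_space S h" "\<And>n. norm (b n) = 1"
    by blast
  obtain c :: "nat \<Rightarrow> 'g" where c: "orthonormal0 c" "\<And>x. (\<And>k. cinner x (c k) = 0) \<Longrightarrow> x = 0"
    using separable_total_orthonormal[OF assms(10)] by blast
  define \<iota> where "\<iota> = basis_change c b"
  define j where "j = basis_change b c"
  have \<iota>: "bounded_clinear \<iota>" and j: "bounded_clinear j"
    unfolding \<iota>_def j_def by (rule bounded_clinear_basis_change[OF c(1) b(1)],
        rule bounded_clinear_basis_change[OF b(1) c(1)])
  have adj: "cinner (\<iota> y) x = cinner y (j x)" "cinner (j x) y = cinner x (\<iota> y)" for x y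
    unfolding \<iota>_def j_def
    by (rule basis_change_adjoint[OF c(1) b(1)], rule basis_change_adjoint[OF b(1) c(1)])
  have j\<iota>: "j (\<iota> y) = y" for y
    unfolding \<iota>_def j_def by (rule basis_change_inverse[OF c(1) b(1) b(3) c(2)])
  \<comment> \<open>\<open>j\<close> only records the coefficients along the vectors
    \<open>b k\<close>, and these are orthogonal to the range of \<open>S - h\<close> since
    \<open>h\<close> is real.\<close>
  have jS: "j (app S x - h *\<^sub>C x) = 0" if "x \<in> dom_of S" for x
  proof -
    have "cinner (app S x - h *\<^sub>C x) (b k) = 0" for k
      using b(2)[of k] that by (simp add: deficiency_space_def cinner_simps h_def)
    then show ?thesis by (simp add: j_def basis_change_def)
  qed
  note lin0 = bounded_clinearD[OF sa_mapD(1)[OF sa0]] and linR = bounded_clinearD[OF sa_mapD(1)[OF sa]]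
    and lini = bounded_clinearD[OF \<iota>] and linj = bounded_clinearD[OF j]

  define B where "B = (\<lambda>x. R0 x + \<iota> (R (j x)))"
  have "bounded_linear B"
    unfolding B_def
    by (intro bounded_linear_add lin0(1) bounded_linear_compose[OF lini(1)]
        bounded_linear_compose[OF linR(1) linj(1)])
  then have B: "sa_map B"
    unfolding sa_map_def bounded_clinear_def
    by (simp add: B_def lin0 linR lini linj scaleC_add_right cinner_simps adj
        sa_mapD(2)[OF sa0] sa_mapD(2)[OF sa])
  have injB: "x = 0" if "B x = 0" for x
  proof -
    define g where "g = R0 x"
    have gdom: "g \<in> dom_of A0" and Ag: "app A0 g = x + h *\<^sub>C g" by (simp_all add: g_def res0)
    have g: "g = - \<iota> (R (j x))" using that by (simp add: B_def g_def eq_neg_iff_add_eq_0)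
    \<comment> \<open>As \<open>x = (A0 - h) g\<close> with \<open>h\<close> real,
      \<open>cinner y x\<close> equals \<open>cinner ((S - h) y) g\<close>; moving \<iota> across
      leaves \<open>j ((S - h) y)\<close>, which is 0.\<close>
    have "cinner y x = 0" if y: "y \<in> dom_of S" for y
    proof -
      have yA: "y \<in> dom_of A0" "app A0 y = app S y" using y ext by (auto simp: extends_def)
      have "cinner (app S y - h *\<^sub>C y) g = 0"
        unfolding g cinner_minus_right adj(2)[symmetric] jS[OF y] by simp
      then show ?thesis
        using self_adjointD(2)[OF A0 yA(1) gdom] by (simp add: yA(2) Ag cinner_simps h_def)
    qed
    then show "x = 0"
      using assms(4) dense_iff_orthogonal[OF linear_opD(1)[OF assms(3)]]
      unfolding densely_defined_def by (meson cinner_zero_commute)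
  qed

  define A where "A = Op (range B) (\<lambda>x. of_real \<eta> *\<^sub>C x + inv B x)"
  have A: "self_adjoint A" "of_real \<eta> \<in> resolvent_set A" "resolvent A (of_real \<eta>) = B"
    unfolding A_def by (rule self_adjoint_from_resolvent[OF B]; erule injB)+
  have "extends A S"
    unfolding extends_def
  proof (intro conjI subsetI ballI)
    fix x assume x: "x \<in> dom_of S"
    then have xA: "x \<in> dom_of A0" "app A0 x = app S x" using ext by (auto simp: extends_def)
    \<comment> \<open>The \<iota>-term vanishes on the range of \<open>S - h\<close>, so there
      \<open>B\<close> agrees with the resolvent of \<open>A0\<close>, which inverts
      \<open>S - h\<close> because \<open>A0\<close> extends \<open>S\<close>.\<close>
    have Bx: "B (app S x - h *\<^sub>C x) = x"
      using res0(3)[OF xA(1)] by (simp add: B_def jS[OF x] xA(2) linR(6) lini(6))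
    then show "x \<in> dom_of A" unfolding A_def by (metis unbounded_op.sel(1) rangeI)
    show "app A x = app S x"
    proof -
      have "resolvent A (of_real \<eta>) (app S x - h *\<^sub>C x) = x" by (simp add: A(3) Bx)
      then show ?thesis
        using resolventD(2)[OF A(2), of "app S x - h *\<^sub>C x"] by (simp add: h_def)
    qed
  qed
  moreover have "z \<in> essential_spectrum A \<longleftrightarrow> z \<in> essential_spectrum \<Xi>" for z
  proof (cases "z = h")
    case False
    define \<mu> where "\<mu> = 1 / (z - h)"
    have "\<mu> \<noteq> 0" using False by (simp add: \<mu>_def)
    have "sequentially_compact_map R0"
      unfolding R0_def h_def by (rule compact_resolvent_sequentially[OF comp \<eta>0])
    then have "semi_fredholm (\<lambda>x. (\<iota> (R (j x)) - \<mu> *\<^sub>C x) + R0 x)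
        \<longleftrightarrow> semi_fredholm (\<lambda>x. \<iota> (R (j x)) - \<mu> *\<^sub>C x)"
      by (rule semi_fredholm_compact_perturbation_iff)
    also have "\<dots> \<longleftrightarrow> semi_fredholm (\<lambda>y. R y - \<mu> *\<^sub>C y)"
      by (rule semi_fredholm_isometry_iff[OF \<iota> j sa_mapD(1)[OF sa] j\<iota> \<open>\<mu> \<noteq> 0\<close>])
    also have "(\<lambda>x. (\<iota> (R (j x)) - \<mu> *\<^sub>C x) + R0 x) = (\<lambda>x. B x - \<mu> *\<^sub>C x)"
      by (simp add: B_def algebra_simps)
    finally show ?thesis
      unfolding essential_spectrum_iff[OF A(1,2)] essential_spectrum_iff[OF \<Xi> \<eta>] A(3)
      by (simp add: \<mu>_def h_def R_def)
  qed (simp add: essential_spectrum_iff[OF A(1,2)] essential_spectrum_iff[OF \<Xi> \<eta>] h_def)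
  ultimately show ?thesis using A(1) by blast
qed

end
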